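(* There is a constant $c>0$ and a family of triangle-free critical graphs which, for every $k\geq 4$, contains infinitely many $k$-chromatic graphs, each member on $n$ vertices having more than $cn^2$ edges. In particular, the density constants satisfy $c_{3,4}\geq \frac{1}{16}$, $c_{3,5}\geq \frac{4}{31}$, and $c_{3,k}=\frac14$ for all $k\geq 6$.
   Context: A graph is $k$-critical if it has chromatic number $k$ and removing any edge allows it to be properly $(k-1)$-colored; a graph is critical if it is $k$-critical for some $k$. The odd-girth of a graph is the length of a shortest odd cycle (so "odd-girth $>3$" means triangle-free). For integers $\ell\geq 3$, $k\geq 4$, the density constant $c_{\ell,k}$ is the supremum of the constants $c$ such that there are infinitely many $k$-critical graphs of odd-girth $>\ell$, each having more than $cn^2$ edges, where $n$ is its number of vertices. *)

theory Defs
  imports Complex_Main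
begin

type_synonym graph = "nat set \<times> nat set set"

definition verts :: "graph \<Rightarrow> nat set" where "verts G = fst G"
definition edges :: "graph \<Rightarrow> nat set set" where "edges G = snd G"

definition simple_graph :: "graph \<Rightarrow> bool" where
  "simple_graph G \<longleftrightarrow> finite (verts G) \<and>
     (\<forall>e\<in>edges G. \<exists>u v. e = {u, v} \<and> u \<noteq> v \<and> u \<in> verts G \<and> v \<in> verts G)"

definition delete_edge :: "graph \<Rightarrow> nat set \<Rightarrow> graph" where
  "delete_edge G e = (verts G, edges G - {e})"

definition colorable :: "graph \<Rightarrow> nat \<Rightarrow> bool" where
  "colorable G k \<longleftrightarrow> (\<exists>f :: nat \<Rightarrow> nat. (\<forall>v\<in>verts G. f v < k) \<and>
      (\<forall>u v. {u, v} \<in> edges G \<longrightarrow> u \<noteq> v \<longrightarrow> f u \<noteq> f v))"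

definition chromatic_number :: "graph \<Rightarrow> nat" where
  "chromatic_number G = (LEAST k. colorable G k)"

definition k_critical :: "graph \<Rightarrow> nat \<Rightarrow> bool" where
  "k_critical G k \<longleftrightarrow> chromatic_number G = k \<and>
     (\<forall>e\<in>edges G. colorable (delete_edge G e) (k - 1))"

definition critical :: "graph \<Rightarrow> bool" where
  "critical G \<longleftrightarrow> (\<exists>k. k_critical G k)"

definition is_cycle :: "graph \<Rightarrow> nat list \<Rightarrow> bool" where
  "is_cycle G vs \<longleftrightarrow> length vs \<ge> 3 \<and> distinct vs \<and> set vs \<subseteq> verts G \<and>
     (\<forall>i < length vs. {vs ! i, vs ! ((i + 1) mod length vs)} \<in> edges G)"

definition odd_girth_gt :: "graph \<Rightarrow> nat \<Rightarrow> bool" where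
  "odd_girth_gt G l \<longleftrightarrow> (\<forall>vs. is_cycle G vs \<and> odd (length vs) \<longrightarrow> length vs > l)"

abbreviation triangle_free :: "graph \<Rightarrow> bool" where
  "triangle_free G \<equiv> odd_girth_gt G 3"

text \<open>"Infinitely many" graphs (up to isomorphism) = graphs with arbitrarily many
  vertices, since there are finitely many graphs of each order up to isomorphism.\<close>
definition density_constant :: "nat \<Rightarrow> nat \<Rightarrow> real" where
  "density_constant l k = Sup {c :: real. \<forall>N :: nat. \<exists>G. simple_graph G \<and>
      k_critical G k \<and> odd_girth_gt G l \<and> card (verts G) \<ge> N \<and>
      real (card (edges G)) > c * (real (card (verts G)))\<^sup>2}"

end

theory Submission
  imports Defs "HOL-Library.FuncSet"
begin

text \<open>Call an independent set \<open>B\<close> of a triangle-free graph a gadget if every \<open>q\<close>-colouring uses more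
  than \<open>n\<close> colours on \<open>B\<close>, while for each \<open>b \<in> B\<close> some \<open>q\<close>-colouring uses only \<open>n\<close> colours on
  \<open>B - {b}\<close>. If two gadgets satisfy \<open>n\<^sub>1 + n\<^sub>2 + 1 = q\<close>, joining \<open>B\<^sub>1\<close> completely to \<open>B\<^sub>2\<close> destroys
  all \<open>q\<close>-colourings, but omitting any one joining edge restores one. So every critical subgraph
  keeps all \<open>|B\<^sub>1| |B\<^sub>2|\<close> joining edges. For \<open>n = 1\<close> match \<open>B\<close> to a critical graph (Toft); for
  larger \<open>n\<close> take \<open>B\<close> to be a product of vertex-critical graphs of chromatic numbers
  \<open>q, q - 1, \<dots>, q - n + 1\<close>, each tuple being joined to its coordinates. Then \<open>B\<close> dwarfs the
  factors, which for \<open>k \<ge> 6\<close> gives density close to \<open>1 / 4\<close>; Mantel's theorem is the upper bound.\<close>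

section \<open>Colourings of triangle-free graphs\<close>

text \<open>The split by \<open>k\<close> comes from \<open>q = k - 1\<close> and
  \<open>n1 + n2 = q - 1\<close>. A gadget with \<open>n = 1\<close> spends one vertex of the
  critical graph on each vertex of \<open>B\<close>, so half of that side takes no part in the join;
  from \<open>n = 2\<close> on the waste is of lower order. For \<open>k = 4\<close> both sides have
  \<open>n = 1\<close>, and \<open>m^2\<close> joining edges on \<open>4 m\<close> vertices give
  1/16. For \<open>k = 5\<close> one side must have \<open>n = 1\<close>; by itself the join would
  give only 1/8, so the matched graph is chosen to be a dense 4-chromatic Toft graph whose own edges
  survive as well, and this yields 4/31. For \<open>k \<ge> 6\<close> both sides can have
  \<open>n \<ge> 2\<close>. A product gadget need not be edge-critical, so its join need not be
  critical either. The argument therefore controls only the edges it counts: each of them is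
  critical for non-colourability, and a minimal non-colourable edge set must contain them.
  Vertex-critical factors suffice for joining edges; edge-critical ones are required where inner
  edges are counted.\<close>

definition tfg :: "'a set \<Rightarrow> ('a \<Rightarrow> 'a \<Rightarrow> bool) \<Rightarrow> bool" where
  "tfg V E \<longleftrightarrow> finite V \<and> (\<forall>u v. E u v \<longrightarrow> u \<in> V \<and> v \<in> V \<and> u \<noteq> v \<and> E v u) \<and>
     (\<forall>u v w. E u v \<longrightarrow> E v w \<longrightarrow> \<not> E u w)"

definition proper :: "'a set \<Rightarrow> ('a \<Rightarrow> 'a \<Rightarrow> bool) \<Rightarrow> nat \<Rightarrow> ('a \<Rightarrow> nat) \<Rightarrow> bool" where
  "proper V E q f \<longleftrightarrow> (\<forall>v\<in>V. f v < q) \<and> (\<forall>u\<in>V. \<forall>v\<in>V. E u v \<longrightarrow> f u \<noteq> f v)"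

definition del :: "('a \<Rightarrow> 'a \<Rightarrow> bool) \<Rightarrow> 'a set \<Rightarrow> 'a \<Rightarrow> 'a \<Rightarrow> bool" where
  "del E e u v \<longleftrightarrow> E u v \<and> {u, v} \<noteq> e"

text \<open>The parameter counts colours that do not suffice: \<open>vcrit q\<close> and \<open>ecrit q\<close> describe
  critical graphs of chromatic number \<open>q + 1\<close>.\<close>

definition vcrit :: "nat \<Rightarrow> 'a set \<Rightarrow> ('a \<Rightarrow> 'a \<Rightarrow> bool) \<Rightarrow> bool" where
  "vcrit q V E \<longleftrightarrow> tfg V E \<and> \<not> (\<exists>f. proper V E q f) \<and> (\<forall>v\<in>V. \<exists>f. proper (V - {v}) E q f)"

definition ecrit :: "nat \<Rightarrow> 'a set \<Rightarrow> ('a \<Rightarrow> 'a \<Rightarrow> bool) \<Rightarrow> bool" where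
  "ecrit q V E \<longleftrightarrow> tfg V E \<and> \<not> (\<exists>f. proper V E q f) \<and>
     (\<forall>u v. E u v \<longrightarrow> (\<exists>f. proper V (del E {u, v}) q f)) \<and> (\<forall>v\<in>V. \<exists>w. E v w)"

lemma tfgD:
  assumes "tfg V E" "E u v"
  shows "u \<in> V" "v \<in> V" "u \<noteq> v" "E v u"
  using assms unfolding tfg_def by blast+

text \<open>Deleting a vertex destroys an edge at it, because \<open>ecrit\<close> excludes isolated
  vertices.\<close>

lemma ecrit_imp_vcrit:
  assumes "ecrit q V E"
  shows "vcrit q V E"
proof -
  have "\<exists>f. proper (V - {v}) E q f" if v: "v \<in> V" for v
  proof -
    obtain w where "E v w" using assms v unfolding ecrit_def by blast
    then obtain f where "proper V (del E {v, w}) q f" using assms unfolding ecrit_def by blast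
    then have "proper (V - {v}) E q f"
      unfolding proper_def del_def by (auto simp: doubleton_eq_iff)
    then show ?thesis by blast
  qed
  then show ?thesis using assms unfolding ecrit_def vcrit_def by blast
qed

text \<open>At most \<open>q\<close> values, whatever they are, could be renamed to
  \<open>0, ..., q - 1\<close>. Since \<open>f\<close> is unbounded, this applies to colourings that
  use a larger palette but avoid some of its colours.\<close>

lemma card_colours_gt:
  assumes V: "finite V" and nc: "\<not> (\<exists>f. proper V E q f)"
    and f: "\<forall>u\<in>V. \<forall>v\<in>V. E u v \<longrightarrow> f u \<noteq> (f v :: nat)"
  shows "q < card (f ` V)"
proof (rule ccontr)
  assume "\<not> q < card (f ` V)"
  then have le: "card (f ` V) \<le> q" by simp
  obtain g where g: "bij_betw g (f ` V) {0..<card (f ` V)}"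
    using V ex_bij_betw_finite_nat by blast
  have "g (f v) < card (f ` V)" if "v \<in> V" for v
    using g that unfolding bij_betw_def by (metis atLeastLessThan_iff imageI)
  moreover have "g (f u) \<noteq> g (f v)" if "u \<in> V" "v \<in> V" "E u v" for u v
    using g f that unfolding bij_betw_def inj_on_def by blast
  ultimately have "proper V E q (g \<circ> f)" using le unfolding proper_def by fastforce
  then show False using nc by blast
qed

text \<open>Giving \<open>v\<close> a private extra colour completes a colouring of the rest. Later
  witness colourings are mostly built from this singleton colour class.\<close>

lemma vcrit_Suc_colouring:
  assumes "vcrit q V E" "v \<in> V"
  obtains f where "f v = q" "\<forall>u\<in>V - {v}. f u < q" "\<forall>u\<in>V. \<forall>w\<in>V. E u w \<longrightarrow> f u \<noteq> f w"
proof -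
  obtain g where g: "proper (V - {v}) E q g" using assms unfolding vcrit_def by blast
  have irr: "\<not> E v v" using assms unfolding vcrit_def tfg_def by blast
  show thesis
  proof (rule that[of "g(v := q)"])
    show "\<forall>u\<in>V. \<forall>w\<in>V. E u w \<longrightarrow> (g(v := q)) u \<noteq> (g(v := q)) w"
    proof (intro ballI impI)
      fix u w assume h: "u \<in> V" "w \<in> V" "E u w"
      then show "(g(v := q)) u \<noteq> (g(v := q)) w"
        using g irr unfolding proper_def by (cases "u = v"; cases "w = v") fastforce+
    qed
  qed (use g in \<open>auto simp: proper_def\<close>)
qed

section \<open>Small critical graphs: odd cycles and Mycielskians\<close>

definition cyc :: "nat \<Rightarrow> nat \<Rightarrow> nat \<Rightarrow> bool" where
  "cyc m u v \<longleftrightarrow> u < m \<and> v < m \<and> (v = Suc u \<or> u = Suc v \<or> Suc u = m \<and> v = 0 \<or> Suc v = m \<and> u = 0)"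

lemma ecrit_cyc:
  assumes m: "odd m" "m \<ge> 5"
  shows "ecrit 2 {..<m} (cyc m)"
  unfolding ecrit_def
proof (intro conjI allI impI ballI)
  show "tfg {..<m} (cyc m)"
    unfolding tfg_def cyc_def using m by auto
  show "\<nexists>f. proper {..<m} (cyc m) 2 f"
  proof
    assume "\<exists>f. proper {..<m} (cyc m) 2 f"
    then obtain f where f: "proper {..<m} (cyc m) 2 f" by blast
    have step: "f (Suc i) = 1 - f i" if "Suc i < m" for i
    proof -
      have "cyc m i (Suc i)" using that by (simp add: cyc_def)
      then have "f i < 2" "f (Suc i) < 2" "f i \<noteq> f (Suc i)"
        using f that unfolding proper_def by auto
      then show ?thesis by arith
    qed
    have f0: "f 0 < 2" using f m unfolding proper_def by auto
    have par: "i < m \<Longrightarrow> f i = (if even i then f 0 else 1 - f 0)" for i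
    proof (induction i)
      case (Suc i)
      then show ?case using step[of i] f0 by auto
    qed simp
    have "f (m - 1) = f 0" using par[of "m - 1"] m by auto
    moreover have "cyc m (m - 1) 0" using m by (auto simp: cyc_def)
    ultimately show False using f m unfolding proper_def by (metis cyc_def lessThan_iff)
  qed
  show "\<exists>w. cyc m v w" if "v \<in> {..<m}" for v
  proof (cases "Suc v = m")
    case True
    then show ?thesis by (intro exI[of _ 0]) (simp add: cyc_def)
  next
    case False
    then show ?thesis using that by (intro exI[of _ "Suc v"]) (simp add: cyc_def)
  qed
  fix u v assume uv: "cyc m u v"
  \<comment> \<open>The removed edge joins \<open>a\<close> to \<open>a + 1\<close>, where
    \<open>a = m\<close> stands for the closing edge between \<open>m - 1\<close> and
    \<open>0\<close>. Colours alternate and change phase just after \<open>a\<close>, so only that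
    edge has equal ends.\<close>
  define a where "a = (if u = 0 \<and> Suc v = m \<or> v = 0 \<and> Suc u = m then m else min u v)"
  define f where "f i = (if i \<le> a then i mod 2 else Suc i mod 2)" for i :: nat
  have "f x \<noteq> f y" if "cyc m x y" "{x, y} \<noteq> {u, v}" for x y
  proof -
    have *: "f x \<noteq> f y"
      if xy: "y < m" "y = Suc x \<or> Suc y = m \<and> x = 0" "{x, y} \<noteq> {u, v}" for x y
    proof -
      consider "Suc y = m" "x = 0" "y \<noteq> Suc x" | "y = Suc x" using xy by blast
      then show ?thesis
      proof cases
        case 1
        then have "a \<noteq> m" "a < y" using uv xy m unfolding a_def cyc_def by (auto simp: doubleton_eq_iff)
        then show ?thesis using 1 m unfolding f_def by (auto simp: mod2_eq_if)
      next
        case 2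
        have "x \<noteq> a"
        proof
          assume "x = a"
          then have "{x, y} = {u, v}" using uv xy 2 unfolding a_def cyc_def
            by (auto simp: min_def split: if_splits)
          then show False using xy by blast
        qed
        then show ?thesis using 2 unfolding f_def by (auto simp: mod2_eq_if)
      qed
    qed
    from that(1) consider "y < m" "y = Suc x \<or> Suc y = m \<and> x = 0" | "x < m" "x = Suc y \<or> Suc x = m \<and> y = 0"
      unfolding cyc_def by blast
    then show ?thesis
    proof cases
      case 1 then show ?thesis using *[of y x] that(2) by blast
    next
      case 2 then show ?thesis using *[of x y] that(2) by (metis insert_commute)
    qed
  qed
  then have "proper {..<m} (del (cyc m) {u, v}) 2 f"
    unfolding proper_def del_def f_def by auto
  then show "\<exists>f. proper {..<m} (del (cyc m) {u, v}) 2 f" by blast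
qed

section \<open>Mycielski's construction\<close>

text \<open>\<open>Some (Inl v)\<close> is an original vertex, \<open>Some (Inr v)\<close> its
  shadow, and \<open>None\<close> the apex over the shadows.\<close>

fun myc :: "('a \<Rightarrow> 'a \<Rightarrow> bool) \<Rightarrow> 'a set \<Rightarrow> ('a + 'a) option \<Rightarrow> ('a + 'a) option \<Rightarrow> bool" where
  "myc E V (Some (Inl u)) (Some (Inl v)) = E u v"
| "myc E V (Some (Inl u)) (Some (Inr v)) = E u v"
| "myc E V (Some (Inr u)) (Some (Inl v)) = E u v"
| "myc E V (Some (Inr u)) None = (u \<in> V)"
| "myc E V None (Some (Inr u)) = (u \<in> V)"
| "myc E V _ _ = False"

definition myc_verts :: "'a set \<Rightarrow> ('a + 'a) option set" where
  "myc_verts V = insert None (Some ` (V <+> V))"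

lemma all_myc: "(\<forall>x. P x) \<longleftrightarrow> P None \<and> (\<forall>u. P (Some (Inl u))) \<and> (\<forall>u. P (Some (Inr u)))"
  by (metis option.exhaust sum.exhaust)

lemma ball_myc: "(\<forall>x\<in>myc_verts V. P x) \<longleftrightarrow>
    P None \<and> (\<forall>u\<in>V. P (Some (Inl u))) \<and> (\<forall>u\<in>V. P (Some (Inr u)))"
  unfolding myc_verts_def by auto

lemma card_myc_verts: "finite V \<Longrightarrow> card (myc_verts V) = 2 * card V + 1"
  unfolding myc_verts_def by (subst card_insert_disjoint) (auto simp: card_image card_Plus)

text \<open>\<open>a\<close>, \<open>b\<close> and \<open>c\<close> colour originals, shadows and
  apex, and \<open>D\<close> holds the deleted vertices. Each vertex deletion is thus reduced to a
  choice of \<open>a\<close>, \<open>b\<close>, \<open>c\<close>.\<close>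

lemma ex_proper_myc:
  assumes sym: "\<And>u v. E u v \<Longrightarrow> E v u"
    and bd: "\<And>u. u \<in> V \<Longrightarrow> Some (Inl u) \<notin> D \<Longrightarrow> a u < q" "\<And>u. u \<in> V \<Longrightarrow> Some (Inr u) \<notin> D \<Longrightarrow> b u < q"
      "None \<notin> D \<Longrightarrow> c < q"
    and aa: "\<And>u v. u \<in> V \<Longrightarrow> v \<in> V \<Longrightarrow> Some (Inl u) \<notin> D \<Longrightarrow> Some (Inl v) \<notin> D \<Longrightarrow> E u v \<Longrightarrow> a u \<noteq> a v"
    and ab: "\<And>u v. u \<in> V \<Longrightarrow> v \<in> V \<Longrightarrow> Some (Inl u) \<notin> D \<Longrightarrow> Some (Inr v) \<notin> D \<Longrightarrow> E u v \<Longrightarrow> a u \<noteq> b v"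
    and bc: "\<And>u. u \<in> V \<Longrightarrow> Some (Inr u) \<notin> D \<Longrightarrow> None \<notin> D \<Longrightarrow> b u \<noteq> c"
  shows "\<exists>f. proper (myc_verts V - D) (myc E V) q f"
proof -
  define h where "h x = (case x of None \<Rightarrow> c | Some y \<Rightarrow> (case y of Inl u \<Rightarrow> a u | Inr u \<Rightarrow> b u))" for x
  have h: "h None = c" "\<And>u. h (Some (Inl u)) = a u" "\<And>u. h (Some (Inr u)) = b u"
    by (simp_all add: h_def)
  have mem: "None \<in> myc_verts V" "\<And>v. Some (Inl v) \<in> myc_verts V \<longleftrightarrow> v \<in> V"
    "\<And>v. Some (Inr v) \<in> myc_verts V \<longleftrightarrow> v \<in> V"
    by (auto simp: myc_verts_def)
  have "\<forall>x. x \<in> myc_verts V - D \<longrightarrow> h x < q"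
    unfolding all_myc using bd by (simp add: h mem)
  moreover have ab': "b u \<noteq> a v"
    if "u \<in> V" "v \<in> V" "Some (Inr u) \<notin> D" "Some (Inl v) \<notin> D" "E u v" for u v
    using ab[of v u] that sym by metis
  have bc': "c \<noteq> b u" if "u \<in> V" "Some (Inr u) \<notin> D" "None \<notin> D" for u
    using bc[of u] that by metis
  have "\<forall>x. \<forall>y. x \<in> myc_verts V - D \<longrightarrow> y \<in> myc_verts V - D \<longrightarrow> myc E V x y \<longrightarrow> h x \<noteq> h y"
    unfolding all_myc by (simp add: h mem) (use aa ab bc ab' bc' in blast)
  ultimately have "proper (myc_verts V - D) (myc E V) q h" unfolding proper_def by blast
  then show ?thesis by blast
qed

lemma vcrit_myc:
  assumes vc: "vcrit q V E" and q: "q \<ge> 1"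
  shows "vcrit (Suc q) (myc_verts V) (myc E V)"
  unfolding vcrit_def
proof (intro conjI)
  have tf: "tfg V E" and nc: "\<not> (\<exists>f. proper V E q f)" using vc unfolding vcrit_def by auto
  have fin: "finite V" and sym: "\<And>u v. E u v \<Longrightarrow> u \<in> V \<and> v \<in> V \<and> u \<noteq> v \<and> E v u"
    and tri: "\<And>u v w. E u v \<Longrightarrow> E v w \<Longrightarrow> \<not> E u w"
    using tf unfolding tfg_def by blast+
  show "tfg (myc_verts V) (myc E V)"
    unfolding tfg_def
  proof (intro conjI)
    show "finite (myc_verts V)" using fin by (simp add: myc_verts_def)
    show "\<forall>x y. myc E V x y \<longrightarrow> x \<in> myc_verts V \<and> y \<in> myc_verts V \<and> x \<noteq> y \<and> myc E V y x"
      unfolding all_myc by (simp add: myc_verts_def image_iff) (use sym in blast)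
    show "\<forall>x y z. myc E V x y \<longrightarrow> myc E V y z \<longrightarrow> \<not> myc E V x z"
      unfolding all_myc by simp (use tri in blast)
  qed
  show "\<nexists>f. proper (myc_verts V) (myc E V) (Suc q) f"
  proof
    assume "\<exists>f. proper (myc_verts V) (myc E V) (Suc q) f"
    then obtain f where f: "proper (myc_verts V) (myc E V) (Suc q) f" by blast
    define c where "c = f None"
    \<comment> \<open>An original that has the apex colour takes the colour of its shadow. This
      frees the apex colour and leaves \<open>q\<close> colours for the original graph.\<close>
    define g where "g v = (if f (Some (Inl v)) = c then f (Some (Inr v)) else f (Some (Inl v)))" for v
    have mem: "None \<in> myc_verts V" "\<And>v. v \<in> V \<Longrightarrow> Some (Inl v) \<in> myc_verts V"
        "\<And>v. v \<in> V \<Longrightarrow> Some (Inr v) \<in> myc_verts V"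
      by (auto simp: myc_verts_def)
    have bd: "\<And>x. x \<in> myc_verts V \<Longrightarrow> f x < Suc q"
      and ne: "\<And>x y. x \<in> myc_verts V \<Longrightarrow> y \<in> myc_verts V \<Longrightarrow> myc E V x y \<Longrightarrow> f x \<noteq> f y"
      using f unfolding proper_def by blast+
    have f': "f None < Suc q" "\<And>v. v \<in> V \<Longrightarrow> f (Some (Inl v)) < Suc q"
       "\<And>v. v \<in> V \<Longrightarrow> f (Some (Inr v)) < Suc q"
      using bd mem by blast+
    have f1: "f (Some (Inr v)) \<noteq> c" if "v \<in> V" for v
      using ne[OF mem(3,1)] that unfolding c_def by simp
    have f2: "f (Some (Inl u)) \<noteq> f (Some (Inl v))" "f (Some (Inl u)) \<noteq> f (Some (Inr v))"
      "f (Some (Inr u)) \<noteq> f (Some (Inl v))" if "E u v" for u v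
      using ne[OF mem(2) mem(2)] ne[OF mem(2) mem(3)] ne[OF mem(3) mem(2)] that sym by simp_all
    have "\<forall>u\<in>V. \<forall>v\<in>V. E u v \<longrightarrow> g u \<noteq> g v"
      unfolding g_def using f1 f2 by metis
    then have "q < card (g ` V)" using card_colours_gt[OF fin nc] by blast
    moreover have "g ` V \<subseteq> {..<Suc q} - {c}" unfolding g_def using f' f1 by (auto simp del: lessThan_Suc)
    then have "card (g ` V) \<le> card ({..<Suc q} - {c})" by (intro card_mono) auto
    moreover have "card ({..<Suc q} - {c}) = q" using f'(1) unfolding c_def by simp
    ultimately show False by simp
  qed
  show "\<forall>v\<in>myc_verts V. \<exists>f. proper (myc_verts V - {v}) (myc E V) (Suc q) f"
  proof -
    have sym': "\<And>u v. E u v \<Longrightarrow> E v u" using sym by blast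
    have part: "\<exists>f. proper (myc_verts V - {None}) (myc E V) (Suc q) f"
        "\<exists>f. proper (myc_verts V - {Some (Inl v)}) (myc E V) (Suc q) f"
        "\<exists>f. proper (myc_verts V - {Some (Inr v)}) (myc E V) (Suc q) f" if v: "v \<in> V" for v
    proof -
      obtain f where f: "f v = q" "\<forall>u\<in>V - {v}. f u < q" "\<forall>u\<in>V. \<forall>w\<in>V. E u w \<longrightarrow> f u \<noteq> f w"
        using vcrit_Suc_colouring[OF vc v] by metis
      have lt: "\<And>u. u \<in> V \<Longrightarrow> u \<noteq> v \<Longrightarrow> f u < q" using f by blast
      then have ne: "\<And>u. u \<in> V \<Longrightarrow> u \<noteq> v \<Longrightarrow> f u \<noteq> q" by blast
      have le: "\<And>u. u \<in> V \<Longrightarrow> f u < Suc q" using f(1) lt less_SucI by (metis lessI)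
      \<comment> \<open>Only \<open>v\<close> has colour \<open>q\<close> under \<open>f\<close>.
        Without the apex, shadows copy their originals. Without the original \<open>v\<close>, no
        original has colour \<open>q\<close>, so all shadows take it and the apex takes
        \<open>0\<close>. Without the shadow of \<open>v\<close>, the other shadows copy their
        originals and the apex takes \<open>q\<close>.\<close>
      show "\<exists>f. proper (myc_verts V - {None}) (myc E V) (Suc q) f"
        by (rule ex_proper_myc[where a = f and b = f]) (use sym' f le in auto)
      show "\<exists>f. proper (myc_verts V - {Some (Inl v)}) (myc E V) (Suc q) f"
        by (rule ex_proper_myc[where a = f and b = "\<lambda>_. q" and c = 0]) (use sym' f(3) q le ne in auto)
      show "\<exists>f. proper (myc_verts V - {Some (Inr v)}) (myc E V) (Suc q) f"
        by (rule ex_proper_myc[where a = f and b = f and c = q]) (use sym' f(3) le ne in auto)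
    qed
    moreover obtain v where "v \<in> V" using nc unfolding proper_def by blast
    ultimately show ?thesis unfolding ball_myc by blast
  qed
qed

definition map_graph :: "('a \<Rightarrow> 'b) \<Rightarrow> ('a \<Rightarrow> 'a \<Rightarrow> bool) \<Rightarrow> 'b \<Rightarrow> 'b \<Rightarrow> bool" where
  "map_graph h E x y \<longleftrightarrow> (\<exists>u v. x = h u \<and> y = h v \<and> E u v)"

lemma vcrit_map_graph:
  assumes inj: "inj_on h V" and vc: "vcrit q V E"
  shows "vcrit q (h ` V) (map_graph h E)"
proof -
  have tf: "tfg V E" and nc: "\<not> (\<exists>f. proper V E q f)" using vc unfolding vcrit_def by auto
  have fin: "finite V" and sym: "\<And>u v. E u v \<Longrightarrow> u \<in> V \<and> v \<in> V \<and> u \<noteq> v \<and> E v u"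
    and tri: "\<And>u v w. E u v \<Longrightarrow> E v w \<Longrightarrow> \<not> E u w"
    using tf unfolding tfg_def by blast+
  have iff: "map_graph h E (h u) (h v) \<longleftrightarrow> E u v" if "u \<in> V" "v \<in> V" for u v
    unfolding map_graph_def using that sym inj by (metis inj_onD)
  have dom: "\<exists>u\<in>V. \<exists>v\<in>V. x = h u \<and> y = h v \<and> E u v" if "map_graph h E x y" for x y
    using that sym unfolding map_graph_def by blast
  have "tfg (h ` V) (map_graph h E)"
    unfolding tfg_def
  proof (intro conjI allI impI)
    show "finite (h ` V)" using fin by simp
    fix x y assume xy: "map_graph h E x y"
    then obtain u v where uv: "u \<in> V" "v \<in> V" "x = h u" "y = h v" "E u v" using dom by blast
    show "x \<in> h ` V" "y \<in> h ` V" using uv by auto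
    show "x \<noteq> y" using uv sym inj by (metis inj_onD)
    show "map_graph h E y x" using uv sym unfolding map_graph_def by blast
    fix z assume "map_graph h E y z"
    then obtain w where "w \<in> V" "z = h w" using dom by blast
    then show "\<not> map_graph h E x z"
      using uv iff tri sym \<open>map_graph h E y z\<close> by blast
  qed
  moreover have "\<not> (\<exists>f. proper (h ` V) (map_graph h E) q f)"
  proof
    assume "\<exists>f. proper (h ` V) (map_graph h E) q f"
    then obtain f where "proper (h ` V) (map_graph h E) q f" by blast
    then have "proper V E q (f \<circ> h)" using iff unfolding proper_def by auto
    then show False using nc by blast
  qed
  moreover have "\<exists>f. proper (h ` V - {x}) (map_graph h E) q f" if x: "x \<in> h ` V" for x
  proof -
    obtain v where v: "v \<in> V" "x = h v" using x by blast
    then obtain f where f: "proper (V - {v}) E q f" using vc unfolding vcrit_def by blast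
    have "proper (h ` V - {x}) (map_graph h E) q (f \<circ> inv_into V h)"
      using f v inj iff unfolding proper_def by auto (metis Diff_iff singletonD)
    then show ?thesis by blast
  qed
  ultimately show ?thesis unfolding vcrit_def by blast
qed

text \<open>Every Mycielskian has a new vertex type, whereas iterating the construction, and
  collecting factors in one indexed family, requires a fixed type.\<close>

lemma vcrit_to_nat:
  assumes "vcrit q V E"
  obtains V' :: "nat set" and E' where "vcrit q V' E'" "card V' = card V"
proof -
  have "finite V" using assms unfolding vcrit_def tfg_def by blast
  then obtain h where "bij_betw h V {0..<card V}" using ex_bij_betw_finite_nat by blast
  then have h: "inj_on h V" by (simp add: bij_betw_def)
  show thesis using that[OF vcrit_map_graph[OF h assms]] card_image[OF h] by simp
qed

text \<open>A cycle of length \<open>2 * m - 1\<close> is the start, and each Mycielskian doubles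
  the number of vertices plus one. For \<open>q = 1\<close> the sizes are all
  \<open>4 * m - 1\<close>, the flexibility used later to balance two sides.\<close>

lemma ex_vcrit:
  assumes "m \<ge> 3"
  shows "\<exists>(V :: nat set) E. vcrit (q + 2) V E \<and> card V = 2 ^ (q + 1) * m - 1"
proof (induction q)
  case 0
  have "odd (2 * m - 1)" "2 * m - 1 \<ge> 5" using assms by auto
  from ecrit_imp_vcrit[OF ecrit_cyc[OF this]] show ?case
    by (intro exI[of _ "{..<2 * m - 1}"] exI[of _ "cyc (2 * m - 1)"]) (simp add: numeral_2_eq_2)
next
  case (Suc q)
  then obtain V :: "nat set" and E where VE: "vcrit (q + 2) V E" "card V = 2 ^ (q + 1) * m - 1" by blast
  have fin: "finite V" using VE unfolding vcrit_def tfg_def by blast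
  have "vcrit (Suc (q + 2)) (myc_verts V) (myc E V)" using vcrit_myc[OF VE(1)] by simp
  then obtain V' :: "nat set" and E' where V': "vcrit (Suc (q + 2)) V' E'" "card V' = card (myc_verts V)"
    using vcrit_to_nat by blast
  have "2 ^ (q + 1) * m \<ge> 1" using assms by simp
  then have "card V' = 2 ^ (Suc q + 1) * m - 1"
    using V'(2) card_myc_verts[OF fin] VE(2) by (simp only: power_Suc add_Suc mult.assoc)
  then show ?case using V' by (intro exI[of _ V'] exI[of _ E']) simp
qed


section \<open>Gadgets\<close>

text \<open>The colours are normalised to \<open>n\<close> on \<open>b\<close> and values below
  \<open>n\<close> elsewhere on \<open>B\<close>, so that reversing the palette of one of two
  gadgets makes their colourings fit together.\<close>

definition gadget :: "nat \<Rightarrow> nat \<Rightarrow> 'a set \<Rightarrow> ('a \<Rightarrow> 'a \<Rightarrow> bool) \<Rightarrow> 'a set \<Rightarrow> bool" where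
  "gadget q n V E B \<longleftrightarrow> tfg V E \<and> B \<subseteq> V \<and> B \<noteq> {} \<and> (\<forall>u\<in>B. \<forall>v\<in>B. \<not> E u v) \<and>
     (\<forall>f. proper V E q f \<longrightarrow> n < card (f ` B)) \<and>
     (\<forall>b\<in>B. \<exists>f. proper V E q f \<and> f b = n \<and> (\<forall>u\<in>B - {b}. f u < n))"

text \<open>What makes an inner edge critical in a join: its removal allows \<open>B\<close> to be
  coloured with only \<open>n\<close> colours. The condition on neighbours provides the absence of
  isolated vertices in \<open>ecrit\<close>.\<close>

definition tight :: "nat \<Rightarrow> nat \<Rightarrow> 'a set \<Rightarrow> ('a \<Rightarrow> 'a \<Rightarrow> bool) \<Rightarrow> 'a set \<Rightarrow> bool" where
  "tight q n V E B \<longleftrightarrow> (\<forall>v\<in>V. \<exists>w. E v w) \<and>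
     (\<forall>u v. E u v \<longrightarrow> (\<exists>f. proper V (del E {u, v}) q f \<and> (\<forall>b\<in>B. f b < n)))"

lemma vcrit_nonempty: "vcrit q V E \<Longrightarrow> V \<noteq> {}"
  unfolding vcrit_def proper_def by auto

section \<open>Gadgets with \<open>n = 1\<close>: a pendant vertex attached to every vertex of a
  critical graph\<close>

definition pend :: "'a set \<Rightarrow> ('a \<Rightarrow> 'a \<Rightarrow> bool) \<Rightarrow> 'a \<times> bool \<Rightarrow> 'a \<times> bool \<Rightarrow> bool" where
  "pend V E x y \<longleftrightarrow> \<not> snd x \<and> \<not> snd y \<and> E (fst x) (fst y) \<or>
     snd x \<noteq> snd y \<and> fst x = fst y \<and> fst x \<in> V"

lemma pendE:
  assumes "pend V E x y"
  obtains (base) u v where "x = (u, False)" "y = (v, False)" "E u v"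
    | (matching) v s where "v \<in> V" "x = (v, s)" "y = (v, \<not> s)"
  using assms unfolding pend_def by (cases x; cases y) auto

text \<open>The private colour of \<open>v\<close> is moved to \<open>0\<close>, so that pendants
  coloured \<open>0\<close> conflict only at \<open>v\<close>, and so that adding \<open>i\<close>
  makes \<open>i\<close> the least colour of a factor.\<close>

lemma reversed_colouring:
  assumes vc: "vcrit q V E" and v: "v \<in> V"
  obtains f where "f v = 0" "\<forall>u\<in>V - {v}. 0 < f u" "\<forall>u\<in>V. f u \<le> q"
    "\<forall>u\<in>V. \<forall>w\<in>V. E u w \<longrightarrow> f u \<noteq> (f w :: nat)"
proof -
  obtain g where g: "g v = q" "\<forall>u\<in>V - {v}. g u < q" "\<forall>u\<in>V. \<forall>w\<in>V. E u w \<longrightarrow> g u \<noteq> g w"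
    using vcrit_Suc_colouring[OF vc v] by metis
  then have le: "\<forall>u\<in>V. g u \<le> q" by (metis Diff_iff less_or_eq_imp_le singletonD)
  have "q - g u \<noteq> q - g w" if "u \<in> V" "w \<in> V" "E u w" for u w
    using that g(3) le by (metis diff_diff_cancel)
  then show thesis
    using g(1,2) by (intro that[of "\<lambda>u. q - g u"]) auto
qed

text \<open>If all pendants had one colour, the base would avoid it and be coloured with
  \<open>q\<close> colours. Conversely, with \<open>0\<close> private to \<open>v\<close> in the
  base, all pendants can take \<open>0\<close> except the one at \<open>v\<close>, which takes
  \<open>1\<close>.\<close>

lemma gadget_pend:
  assumes vc: "vcrit q V E" and q: "q \<ge> 1"
  shows "gadget (Suc q) 1 (V \<times> UNIV) (pend V E) (V \<times> {True})"
  unfolding gadget_def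
proof (intro conjI ballI allI impI)
  have tf: "tfg V E" and nc: "\<not> (\<exists>f. proper V E q f)" using vc unfolding vcrit_def by auto
  have fin: "finite V" and sym: "\<And>u v. E u v \<Longrightarrow> u \<in> V \<and> v \<in> V \<and> u \<noteq> v \<and> E v u"
    and tri: "\<And>u v w. E u v \<Longrightarrow> E v w \<Longrightarrow> \<not> E u w"
    using tf unfolding tfg_def by blast+
  show "tfg (V \<times> UNIV) (pend V E)"
    unfolding tfg_def
  proof (intro conjI)
    show "\<forall>x y. pend V E x y \<longrightarrow> x \<in> V \<times> UNIV \<and> y \<in> V \<times> UNIV \<and> x \<noteq> y \<and> pend V E y x"
      unfolding pend_def by (simp add: mem_Times_iff prod_eq_iff) (use sym in blast)
    show "\<forall>x y z. pend V E x y \<longrightarrow> pend V E y z \<longrightarrow> \<not> pend V E x z"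
      unfolding pend_def by simp (use tri sym in metis)
  qed (use fin in simp)
  show "V \<times> {True} \<subseteq> V \<times> UNIV" by auto
  show ne: "V \<times> {True} \<noteq> {}" using vcrit_nonempty[OF vc] by simp
  show "\<not> pend V E x y" if "x \<in> V \<times> {True}" "y \<in> V \<times> {True}" for x y
    using that by (auto simp: pend_def)
  show "1 < card (f ` (V \<times> {True}))" if f: "proper (V \<times> UNIV) (pend V E) (Suc q) f" for f
  proof (rule ccontr)
    assume "\<not> 1 < card (f ` (V \<times> {True}))"
    moreover have "card (f ` (V \<times> {True})) \<noteq> 0" using fin ne by (subst card_0_eq) auto
    ultimately have "card (f ` (V \<times> {True})) = 1" by linarith
    then obtain c where c: "f ` (V \<times> {True}) = {c}" by (rule card_1_singletonE)
    have fc: "f (v, True) = c" if "v \<in> V" for v using c that by blast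
    have bd: "f (v, s) < Suc q" if "v \<in> V" for v s using f that unfolding proper_def by blast
    have pr: "f x \<noteq> f y" if "x \<in> V \<times> UNIV" "y \<in> V \<times> UNIV" "pend V E x y" for x y
      using f that unfolding proper_def by blast
    have ad: "f (v, False) \<noteq> f (v, True)" if "v \<in> V" for v
      using pr[of "(v, False)" "(v, True)"] that by (simp add: pend_def)
    have "\<forall>u\<in>V. \<forall>v\<in>V. E u v \<longrightarrow> f (u, False) \<noteq> f (v, False)"
      using pr by (simp add: pend_def)
    then have "q < card ((\<lambda>v. f (v, False)) ` V)" by (rule card_colours_gt[OF fin nc])
    moreover have "(\<lambda>v. f (v, False)) ` V \<subseteq> {..<Suc q} - {c}"
      using bd ad fc by (auto simp del: lessThan_Suc)
    then have "card ((\<lambda>v. f (v, False)) ` V) \<le> card ({..<Suc q} - {c})" by (intro card_mono) auto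
    moreover have "c < Suc q" using ne fc bd by auto
    ultimately show False by simp
  qed
  fix b assume "b \<in> V \<times> {True}"
  then obtain v where v: "v \<in> V" "b = (v, True)" by blast
  obtain g where g: "g v = 0" "\<forall>u\<in>V - {v}. 0 < g u" "\<forall>u\<in>V. g u \<le> q"
    "\<forall>u\<in>V. \<forall>w\<in>V. E u w \<longrightarrow> g u \<noteq> (g w :: nat)"
    using reversed_colouring[OF vc v(1)] by metis
  define f where "f x = (if snd x then if fst x = v then 1 else 0 else g (fst x))" for x
  have "proper (V \<times> UNIV) (pend V E) (Suc q) f"
    unfolding proper_def
  proof (intro conjI ballI impI)
    fix x assume "x \<in> V \<times> (UNIV :: bool set)"
    then show "f x < Suc q" using g(3) q by (auto simp: f_def)
  next
    fix x y assume "pend V E x y"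
    then show "f x \<noteq> f y"
    proof (cases rule: pendE)
      case (base u v)
      then show ?thesis using g(4) sym by (auto simp: f_def)
    next
      case (matching u s)
      then show ?thesis using g(1,2) by (cases s; cases "u = v") (auto simp: f_def)
    qed
  qed
  moreover have "f b = 1" "\<forall>u\<in>V \<times> {True} - {b}. f u < 1" using v by (auto simp: f_def)
  ultimately show "\<exists>f. proper (V \<times> UNIV) (pend V E) (Suc q) f \<and> f b = 1 \<and>
      (\<forall>u\<in>V \<times> {True} - {b}. f u < 1)" by blast
qed

text \<open>All pendants take colour \<open>0\<close>. If a base edge is missing, the base fits into
  the remaining colours \<open>1, ..., q\<close>; if the pendant edge at \<open>v\<close> is
  missing, \<open>v\<close> may itself have \<open>0\<close> as its private colour.\<close>

lemma tight_pend:
  assumes ec: "ecrit q V E"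
  shows "tight (Suc q) 1 (V \<times> UNIV) (pend V E) (V \<times> {True})"
  unfolding tight_def
proof (intro conjI ballI allI impI)
  note vc = ecrit_imp_vcrit[OF ec]
  have sym: "\<And>u v. E u v \<Longrightarrow> u \<in> V \<and> v \<in> V \<and> u \<noteq> v \<and> E v u"
    using ec unfolding ecrit_def tfg_def by blast
  show "\<exists>w. pend V E x w" if "x \<in> V \<times> UNIV" for x
    using that by (intro exI[of _ "(fst x, \<not> snd x)"]) (auto simp: pend_def)
  have matching_edge: "\<exists>f. proper (V \<times> UNIV) (del (pend V E) {(v, False), (v, True)}) (Suc q) f \<and>
      (\<forall>b\<in>V \<times> {True}. f b < 1)" if v: "v \<in> V" for v
  proof -
    obtain g where g: "g v = 0" "\<forall>u\<in>V - {v}. 0 < g u" "\<forall>u\<in>V. g u \<le> q"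
      "\<forall>u\<in>V. \<forall>w\<in>V. E u w \<longrightarrow> g u \<noteq> (g w :: nat)"
      using reversed_colouring[OF vc v] by metis
    define f where "f x = (if snd x then 0 else g (fst x))" for x :: "'a \<times> bool"
    have "proper (V \<times> UNIV) (del (pend V E) {(v, False), (v, True)}) (Suc q) f"
      unfolding proper_def
    proof (intro conjI ballI impI)
      fix x assume "x \<in> V \<times> (UNIV :: bool set)"
      then show "f x < Suc q" using g(3) by (auto simp: f_def)
    next
      fix x y assume "x \<in> V \<times> (UNIV :: bool set)" "y \<in> V \<times> (UNIV :: bool set)"
        and "del (pend V E) {(v, False), (v, True)} x y"
      then have "pend V E x y" "{x, y} \<noteq> {(v, False), (v, True)}" by (auto simp: del_def)
      from this(1) show "f x \<noteq> f y"
      proof (cases rule: pendE)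
        case (base u w)
        then show ?thesis using g(4) sym by (auto simp: f_def)
      next
        case (matching u s)
        then have "u \<noteq> v" using \<open>{x, y} \<noteq> _\<close> by (cases s) auto
        then show ?thesis using matching g(2) by (cases s) (auto simp: f_def)
      qed
    qed
    then show ?thesis by (intro exI[of _ f]) (auto simp: f_def)
  qed
  fix x y assume "pend V E x y"
  then show "\<exists>f. proper (V \<times> UNIV) (del (pend V E) {x, y}) (Suc q) f \<and> (\<forall>b\<in>V \<times> {True}. f b < 1)"
  proof (cases rule: pendE)
    case (base u v)
    then obtain g where g: "proper V (del E {u, v}) q g" using ec unfolding ecrit_def by blast
    define f where "f x = (if snd x then 0 else Suc (g (fst x)))" for x :: "'a \<times> bool"
    have "proper (V \<times> UNIV) (del (pend V E) {x, y}) (Suc q) f"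
      unfolding proper_def
    proof (intro conjI ballI impI)
      fix z assume "z \<in> V \<times> (UNIV :: bool set)"
      then show "f z < Suc q" using g by (auto simp: f_def proper_def)
    next
      fix z z' assume "del (pend V E) {x, y} z z'"
      then have "pend V E z z'" "{z, z'} \<noteq> {x, y}" by (auto simp: del_def)
      from this(1) show "f z \<noteq> f z'"
      proof (cases rule: pendE)
        case (base u' v')
        then have "del E {u, v} u' v'" "u' \<in> V" "v' \<in> V"
          using \<open>{z, z'} \<noteq> _\<close> \<open>x = _\<close> \<open>y = _\<close> sym[OF \<open>E u' v'\<close>] unfolding del_def by (auto simp: doubleton_eq_iff)
        then show ?thesis using base g by (auto simp: f_def proper_def)
      next
        case (matching u' s)
        then show ?thesis by (cases s) (auto simp: f_def)
      qed
    qed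
    then show ?thesis by (intro exI[of _ f]) (auto simp: f_def)
  next
    case (matching v s)
    then have "{x, y} = {(v, False), (v, True)}" by (cases s) auto
    then show ?thesis using matching_edge[OF matching(1)] by simp
  qed
qed

section \<open>Gadgets for general \<open>n\<close>: products of critical graphs\<close>

text \<open>\<open>Inl (i, u)\<close> is the vertex \<open>u\<close> of factor \<open>i\<close>, and
  \<open>Inr t\<close> is a tuple. \<open>PiE\<close> makes a tuple determined by its
  \<open>n\<close> coordinates.\<close>

fun prodg :: "nat \<Rightarrow> (nat \<Rightarrow> 'a set) \<Rightarrow> (nat \<Rightarrow> 'a \<Rightarrow> 'a \<Rightarrow> bool) \<Rightarrow>
    (nat \<times> 'a) + (nat \<Rightarrow> 'a) \<Rightarrow> (nat \<times> 'a) + (nat \<Rightarrow> 'a) \<Rightarrow> bool" where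
  "prodg n V E (Inl x) (Inl y) \<longleftrightarrow> fst x = fst y \<and> fst x < n \<and> E (fst x) (snd x) (snd y)"
| "prodg n V E (Inl x) (Inr t) \<longleftrightarrow> fst x < n \<and> t \<in> PiE {..<n} V \<and> t (fst x) = snd x"
| "prodg n V E (Inr t) (Inl x) \<longleftrightarrow> fst x < n \<and> t \<in> PiE {..<n} V \<and> t (fst x) = snd x"
| "prodg n V E (Inr t) (Inr t') \<longleftrightarrow> False"

lemma prodgE:
  assumes "prodg n V E x y"
  obtains (base) i u v where "x = Inl (i, u)" "y = Inl (i, v)" "i < n" "E i u v"
    | (up) i t where "x = Inl (i, t i)" "y = Inr t" "i < n" "t \<in> PiE {..<n} V"
    | (down) i t where "x = Inr t" "y = Inl (i, t i)" "i < n" "t \<in> PiE {..<n} V"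
proof (cases x)
  case (Inl a)
  show thesis
  proof (cases y)
    case y: (Inl b)
    then show thesis using base[of "fst a" "snd a" "snd b"] Inl assms by (cases a; cases b) auto
  next
    case y: (Inr t)
    then show thesis using up[of "fst a" t] Inl assms by (cases a) auto
  qed
next
  case (Inr t)
  show thesis
  proof (cases y)
    case y: (Inl b)
    then show thesis using down[of t "fst b"] Inr assms by (cases b) auto
  next
    case y: (Inr t')
    then show thesis using Inr assms by simp
  qed
qed

definition prodg_base :: "nat \<Rightarrow> (nat \<Rightarrow> 'a set) \<Rightarrow> ((nat \<times> 'a) + (nat \<Rightarrow> 'a)) set" where
  "prodg_base n V = Inl ` (SIGMA i:{..<n}. V i)"

definition prodg_top :: "nat \<Rightarrow> (nat \<Rightarrow> 'a set) \<Rightarrow> ((nat \<times> 'a) + (nat \<Rightarrow> 'a)) set" where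
  "prodg_top n V = Inr ` PiE {..<n} V"

lemma all_sum: "(\<forall>x. P x) \<longleftrightarrow> (\<forall>u. P (Inl u)) \<and> (\<forall>u. P (Inr u))"
  by (metis sum.exhaust)

text \<open>Factor \<open>i\<close> misses at most \<open>i\<close> of the \<open>q\<close> colours, so the colours of a small set can be
  hit greedily, starting from the last factor.\<close>
lemma greedy_transversal:
  assumes vc: "\<And>i. i < n \<Longrightarrow> vcrit (q - 1 - i) (V i) (E i)" and "n < q"
    and bd: "\<And>i u. i < n \<Longrightarrow> u \<in> V i \<Longrightarrow> f i u < q"
    and pr: "\<And>i u v. i < n \<Longrightarrow> E i u v \<Longrightarrow> f i u \<noteq> (f i v :: nat)"
  shows "m \<le> n \<Longrightarrow> S \<subseteq> {..<q} \<Longrightarrow> card S \<le> m \<Longrightarrow>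
    \<exists>t \<in> PiE {..<m} V. S \<subseteq> (\<lambda>i. f i (t i)) ` {..<m}"
proof (induction m arbitrary: S)
  case 0
  then have "S = {}" using finite_subset[of S "{..<q}"] by auto
  then show ?case by auto
next
  case (Suc m)
  have m: "m < n" using Suc by simp
  have finS: "finite S" using Suc.prems finite_subset by blast
  have fin: "finite (V m)" and nc: "\<not> (\<exists>f. proper (V m) (E m) (q - 1 - m) f)"
    using vc[OF m] unfolding vcrit_def tfg_def by blast+
  obtain u where u: "u \<in> V m" "card (S - {f m u}) \<le> m"
  proof (cases "card S \<le> m")
    case True
    obtain u where "u \<in> V m" using vcrit_nonempty[OF vc[OF m]] by blast
    then show thesis using that[of u] True card_Diff1_le[of S "f m u"] by linarith
  next
    case False
    have "q - 1 - m < card (f m ` V m)"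
      using card_colours_gt[OF fin nc] pr[OF m] by blast
    moreover have "card (S \<union> f m ` V m) \<le> card {..<q}"
      using bd[OF m] Suc.prems by (intro card_mono) auto
    \<comment> \<open>Here \<open>S\<close> has \<open>m + 1\<close> colours and factor
      \<open>m\<close> shows at least \<open>q - m\<close>, one too many for disjoint subsets of a
      palette of size \<open>q\<close>.\<close>
    ultimately have "S \<inter> f m ` V m \<noteq> {}"
      using card_Un_disjoint[of S "f m ` V m"] fin finS False m \<open>n < q\<close> by auto
    then obtain u where u: "u \<in> V m" "f m u \<in> S" by blast
    then show thesis using that[of u] Suc.prems finS by auto
  qed
  obtain t where t: "t \<in> PiE {..<m} V" "S - {f m u} \<subseteq> (\<lambda>i. f i (t i)) ` {..<m}"
    using Suc.IH[of "S - {f m u}"] Suc.prems u by auto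
  have "t(m := u) \<in> PiE {..<Suc m} V"
    using t u unfolding lessThan_Suc by (intro PiE_fun_upd)
  moreover have "S \<subseteq> (\<lambda>i. f i ((t(m := u)) i)) ` {..<Suc m}"
  proof
    fix s assume "s \<in> S"
    show "s \<in> (\<lambda>i. f i ((t(m := u)) i)) ` {..<Suc m}"
    proof (cases "s = f m u")
      case True
      then show ?thesis by (intro image_eqI[of _ _ m]) auto
    next
      case False
      then obtain i where "i < m" "s = f i (t i)" using t \<open>s \<in> S\<close> by blast
      then show ?thesis by (intro image_eqI[of _ _ i]) auto
    qed
  qed
  ultimately show ?case by blast
qed

text \<open>If the tuples used at most \<open>n\<close> colours, a transversal \<open>t\<close>
  would meet all of them, and the vertex \<open>Inr t\<close>, adjacent to its coordinates, would
  have no colour left.\<close>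

lemma gadget_prodg:
  assumes vc: "\<And>i. i < n \<Longrightarrow> vcrit (q - 1 - i) (V i) (E i)" and nq: "n < q"
  shows "gadget q n (prodg_base n V \<union> prodg_top n V) (prodg n V E) (prodg_top n V)"
  unfolding gadget_def
proof (intro conjI ballI allI impI)
  have fin: "\<And>i. i < n \<Longrightarrow> finite (V i)"
    and sym: "\<And>i u v. i < n \<Longrightarrow> E i u v \<Longrightarrow> u \<in> V i \<and> v \<in> V i \<and> u \<noteq> v \<and> E i v u"
    and tri: "\<And>i u v w. i < n \<Longrightarrow> E i u v \<Longrightarrow> E i v w \<Longrightarrow> \<not> E i u w"
    using vc unfolding vcrit_def tfg_def by blast+
  have mem: "Inl x \<in> prodg_base n V \<union> prodg_top n V \<longleftrightarrow> fst x < n \<and> snd x \<in> V (fst x)"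
    "Inr t \<in> prodg_base n V \<union> prodg_top n V \<longleftrightarrow> t \<in> PiE {..<n} V" for x t
    unfolding prodg_base_def prodg_top_def by (cases x) auto
  show "tfg (prodg_base n V \<union> prodg_top n V) (prodg n V E)"
    unfolding tfg_def
  proof (intro conjI)
    show "finite (prodg_base n V \<union> prodg_top n V)"
      unfolding prodg_base_def prodg_top_def using fin by (auto intro!: finite_PiE)
    show "\<forall>x y. prodg n V E x y \<longrightarrow> x \<in> prodg_base n V \<union> prodg_top n V \<and>
        y \<in> prodg_base n V \<union> prodg_top n V \<and> x \<noteq> y \<and> prodg n V E y x"
      unfolding all_sum mem prodg.simps using sym by (auto dest: PiE_mem)
    have irr: "\<not> E i u u" if "i < n" for i u using sym[OF that] by blast
    show "\<forall>x y z. prodg n V E x y \<longrightarrow> prodg n V E y z \<longrightarrow> \<not> prodg n V E x z"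
    proof (intro allI impI notI)
      fix x y z assume xy: "prodg n V E x y" and yz: "prodg n V E y z" and xz: "prodg n V E x z"
      from xy show False
      proof (cases rule: prodgE)
        case (base i u v)
        then show False using yz xz irr tri[OF base(3,4)] by (cases z) auto
      next
        case (up i t)
        then show False using yz xz irr by (cases z) auto
      next
        case (down i t)
        then show False using yz xz irr by (cases z) auto
      qed
    qed
  qed
  show "prodg_top n V \<subseteq> prodg_base n V \<union> prodg_top n V" by blast
  show "prodg_top n V \<noteq> {}"
    using vcrit_nonempty[OF vc] unfolding prodg_top_def by (auto simp: PiE_eq_empty_iff)
  show "\<not> prodg n V E x y" if "x \<in> prodg_top n V" "y \<in> prodg_top n V" for x y
  proof
    assume "prodg n V E x y"
    then show False using that by (cases rule: prodgE) (auto simp: prodg_top_def)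
  qed
  show "n < card (f ` prodg_top n V)"
    if f: "proper (prodg_base n V \<union> prodg_top n V) (prodg n V E) q f" for f
  proof (rule ccontr)
    assume "\<not> n < card (f ` prodg_top n V)"
    then have le: "card (f ` prodg_top n V) \<le> n" by simp
    have bd: "f x < q" if "x \<in> prodg_base n V \<union> prodg_top n V" for x
      using f that unfolding proper_def by blast
    have pr: "f x \<noteq> f y"
      if "x \<in> prodg_base n V \<union> prodg_top n V" "y \<in> prodg_base n V \<union> prodg_top n V" "prodg n V E x y" for x y
      using f that unfolding proper_def by blast
    have "\<exists>t \<in> PiE {..<n} V. f ` prodg_top n V \<subseteq> (\<lambda>i. f (Inl (i, t i))) ` {..<n}"
    proof (rule greedy_transversal[OF vc nq _ _ order_refl _ le])
      show "f (Inl (i, u)) < q" if "i < n" "u \<in> V i" for i u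
        by (rule bd) (simp only: mem fst_conv snd_conv that)
      show "f (Inl (i, u)) \<noteq> f (Inl (i, v))" if "i < n" "E i u v" for i u v
      proof (rule pr)
        show "prodg n V E (Inl (i, u)) (Inl (i, v))" using that by simp
      qed (simp_all only: mem fst_conv snd_conv that sym[OF that])
      show "f ` prodg_top n V \<subseteq> {..<q}" using bd by blast
    qed
    then obtain t where t: "t \<in> PiE {..<n} V" "f ` prodg_top n V \<subseteq> (\<lambda>i. f (Inl (i, t i))) ` {..<n}"
      by blast
    have "f (Inr t) \<in> f ` prodg_top n V" using t unfolding prodg_top_def by blast
    then obtain i where i: "i < n" "f (Inr t) = f (Inl (i, t i))" using t by blast
    have "f (Inl (i, t i)) \<noteq> f (Inr t)"
    proof (rule pr)
      show "prodg n V E (Inl (i, t i)) (Inr t)" using t i by simp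
    qed (use t i PiE_mem[OF t(1), of i] in \<open>simp_all only: mem fst_conv snd_conv lessThan_iff\<close>)
    then show False using i by simp
  qed
  fix b assume "b \<in> prodg_top n V"
  then obtain t where t: "t \<in> PiE {..<n} V" "b = Inr t" unfolding prodg_top_def by blast
  have "\<forall>i. \<exists>g. i < n \<longrightarrow> g (t i) = 0 \<and> (\<forall>u\<in>V i - {t i}. 0 < g u) \<and> (\<forall>u\<in>V i. g u \<le> q - 1 - i) \<and>
      (\<forall>u\<in>V i. \<forall>w\<in>V i. E i u w \<longrightarrow> g u \<noteq> (g w :: nat))"
  proof
    fix i
    show "\<exists>g. i < n \<longrightarrow> g (t i) = 0 \<and> (\<forall>u\<in>V i - {t i}. 0 < g u) \<and> (\<forall>u\<in>V i. g u \<le> q - 1 - i) \<and>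
      (\<forall>u\<in>V i. \<forall>w\<in>V i. E i u w \<longrightarrow> g u \<noteq> (g w :: nat))"
    proof (cases "i < n")
      case True
      then have "t i \<in> V i" using t by (auto dest: PiE_mem)
      then show ?thesis using reversed_colouring[OF vc[OF True]] by metis
    qed simp
  qed
  from choice[OF this] obtain g where
    "\<forall>i. i < n \<longrightarrow> g i (t i) = 0 \<and> (\<forall>u\<in>V i - {t i}. 0 < g i u) \<and> (\<forall>u\<in>V i. g i u \<le> q - 1 - i) \<and>
      (\<forall>u\<in>V i. \<forall>w\<in>V i. E i u w \<longrightarrow> g i u \<noteq> (g i w :: nat))" by blast
  then have g: "\<And>i. i < n \<Longrightarrow> g i (t i) = 0" "\<And>i u. i < n \<Longrightarrow> u \<in> V i - {t i} \<Longrightarrow> 0 < g i u"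
    "\<And>i u. i < n \<Longrightarrow> u \<in> V i \<Longrightarrow> g i u \<le> q - 1 - i"
    "\<And>i u w. i < n \<Longrightarrow> u \<in> V i \<Longrightarrow> w \<in> V i \<Longrightarrow> E i u w \<Longrightarrow> g i u \<noteq> (g i w :: nat)"
    by blast+
  \<comment> \<open>The first coordinate where \<open>t'\<close> departs from \<open>t\<close>, with
    default \<open>n\<close>; hence \<open>t\<close> is the only tuple of colour \<open>n\<close>.
    In factor \<open>i\<close> the colour of \<open>t i\<close> is \<open>i\<close>, and all other
    vertices have larger colours, up to \<open>q - 1\<close>.\<close>
  define d where "d t' = (LEAST i. i = n \<or> t' i \<noteq> t i)" for t'
  define f where "f x = (case x of Inl y \<Rightarrow> fst y + g (fst y) (snd y) | Inr t' \<Rightarrow> d t')" for x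
  have d1: "d t' = n \<or> t' (d t') \<noteq> t (d t')" for t'
    unfolding d_def by (rule LeastI[of "\<lambda>i. i = n \<or> t' i \<noteq> t i" n]) simp
  have d2: "d t' \<le> n" for t'
    unfolding d_def by (rule Least_le) simp
  have dlt: "t' i = t i" if "i < d t'" for t' i
    using not_less_Least[OF that[unfolded d_def]] by blast
  \<comment> \<open>Before the first departure the coordinate has colour \<open>i < d t'\<close>; at
    it, a colour above \<open>i = d t'\<close>; after it, a colour at least
    \<open>i > d t'\<close>.\<close>
  have cross: "i + g i (t' i) \<noteq> d t'" if "i < n" "t' \<in> PiE {..<n} V" for i t'
  proof -
    have ti: "t' i \<in> V i" using that by (auto dest: PiE_mem)
    consider "i < d t'" | "i = d t'" | "i > d t'" by linarith
    then show ?thesis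
    proof cases
      case 1
      then show ?thesis using dlt[OF 1] g(1)[OF that(1)] by simp
    next
      case 2
      then have "t' i \<noteq> t i" using d1[of t'] that(1) by auto
      then show ?thesis using g(2)[OF that(1), of "t' i"] ti 2 by auto
    qed simp
  qed
  have "proper (prodg_base n V \<union> prodg_top n V) (prodg n V E) q f"
    unfolding proper_def
  proof (intro conjI ballI impI)
    fix x assume x: "x \<in> prodg_base n V \<union> prodg_top n V"
    show "f x < q"
    proof (cases x)
      case (Inl y)
      then have y: "fst y < n" "snd y \<in> V (fst y)" using x by (simp_all only: mem)
      show ?thesis using g(3)[OF y] y nq unfolding f_def Inl by simp
    next
      case (Inr t')
      then show ?thesis using d2[of t'] nq by (simp add: f_def)
    qed
  next
    fix x y assume E: "prodg n V E x y"
    from E show "f x \<noteq> f y"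
    proof (cases rule: prodgE)
      case (base i u v)
      then show ?thesis using g(4)[of i u v] sym[OF base(3,4)] by (simp add: f_def)
    next
      case (up i t')
      then show ?thesis using cross[of i t'] by (simp add: f_def)
    next
      case (down i t')
      then show ?thesis using cross[of i t'] by (simp add: f_def)
    qed
  qed
  moreover have "f b = n"
  proof -
    have "d t = n" using d1[of t] by simp
    then show ?thesis by (simp add: f_def t)
  qed
  moreover have "\<forall>u\<in>prodg_top n V - {b}. f u < n"
  proof
    fix u assume "u \<in> prodg_top n V - {b}"
    then obtain t' where t': "t' \<in> PiE {..<n} V" "u = Inr t'" "t' \<noteq> t"
      unfolding prodg_top_def t by blast
    have "d t' \<noteq> n"
    proof
      assume "d t' = n"
      then have "t' i = t i" if "i < n" for i using dlt that by simp
      then have "t' = t" using PiE_ext[OF t'(1) t(1)] by simp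
      then show False using t' by simp
    qed
    then show "f u < n" using d2[of t'] by (simp add: f_def t')
  qed
  ultimately show "\<exists>f. proper (prodg_base n V \<union> prodg_top n V) (prodg n V E) q f \<and> f b = n \<and>
      (\<forall>u\<in>prodg_top n V - {b}. f u < n)" by blast
qed


section \<open>Joining two gadgets\<close>

fun bip :: "('a \<Rightarrow> 'a \<Rightarrow> bool) \<Rightarrow> 'a set \<Rightarrow> ('b \<Rightarrow> 'b \<Rightarrow> bool) \<Rightarrow> 'b set \<Rightarrow> 'a + 'b \<Rightarrow> 'a + 'b \<Rightarrow> bool" where
  "bip E1 B1 E2 B2 (Inl u) (Inl v) \<longleftrightarrow> E1 u v"
| "bip E1 B1 E2 B2 (Inr u) (Inr v) \<longleftrightarrow> E2 u v"
| "bip E1 B1 E2 B2 (Inl u) (Inr v) \<longleftrightarrow> u \<in> B1 \<and> v \<in> B2"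
| "bip E1 B1 E2 B2 (Inr v) (Inl u) \<longleftrightarrow> u \<in> B1 \<and> v \<in> B2"

text \<open>The relation \<open>R\<close> is left general so that the lemma applies to a join from
  which any one edge has been removed.\<close>

lemma proper_sum:
  assumes f1: "proper V1 E1 q f1" and f2: "proper V2 E2 q f2"
    and R1: "\<And>u v. R (Inl u) (Inl v) \<Longrightarrow> E1 u v" and R2: "\<And>u v. R (Inr u) (Inr v) \<Longrightarrow> E2 u v"
    and cr: "\<And>u v. R (Inl u) (Inr v) \<or> R (Inr v) (Inl u) \<Longrightarrow> f1 u \<noteq> f2 v"
  shows "proper (V1 <+> V2) R q (case_sum f1 f2)"
  unfolding proper_def
proof (intro conjI ballI impI)
  fix x assume "x \<in> V1 <+> V2"
  then show "case_sum f1 f2 x < q" using f1 f2 unfolding proper_def by auto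
next
  fix x y assume xy: "x \<in> V1 <+> V2" "y \<in> V1 <+> V2" "R x y"
  show "case_sum f1 f2 x \<noteq> case_sum f1 f2 y"
  proof (cases x; cases y)
    fix u v assume h: "x = Inl u" "y = Inl v"
    then have "E1 u v" "u \<in> V1" "v \<in> V1" using R1 xy by auto
    then show ?thesis using f1 h unfolding proper_def by simp
  next
    fix u v assume h: "x = Inr u" "y = Inr v"
    then have "E2 u v" "u \<in> V2" "v \<in> V2" using R2 xy by auto
    then show ?thesis using f2 h unfolding proper_def by simp
  next
    fix u v assume h: "x = Inl u" "y = Inr v"
    then show ?thesis using cr[of u v] xy by simp
  next
    fix u v assume h: "x = Inr v" "y = Inl u"
    then have "f1 u \<noteq> f2 v" using cr[of u v] xy by simp
    then show ?thesis using h by simp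
  qed
qed

lemma proper_reverse:
  assumes "proper V E q f"
  shows "proper V E q (\<lambda>u. q - 1 - f u)"
proof -
  have "q - 1 - f u \<noteq> q - 1 - f v" if "u \<in> V" "v \<in> V" "E u v" for u v
  proof -
    have "f u < q" "f v < q" "f u \<noteq> f v" using assms that unfolding proper_def by auto
    then show ?thesis by linarith
  qed
  moreover have "q - 1 - f u < q" if "u \<in> V" for u
    using assms that unfolding proper_def by fastforce
  ultimately show ?thesis unfolding proper_def by blast
qed

lemma gadgetD:
  assumes "gadget q n V E B"
  shows "tfg V E" "finite V" "B \<subseteq> V" "finite B" "B \<noteq> {}" "\<And>u v. u \<in> B \<Longrightarrow> v \<in> B \<Longrightarrow> \<not> E u v"
    "\<And>f. proper V E q f \<Longrightarrow> n < card (f ` B)"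
    "\<And>b. b \<in> B \<Longrightarrow> \<exists>f. proper V E q f \<and> f b = n \<and> (\<forall>u\<in>B - {b}. f u < n)"
proof -
  show "tfg V E" "B \<subseteq> V" "B \<noteq> {}" using assms unfolding gadget_def by blast+
  then show "finite V" unfolding tfg_def by blast
  then show "finite B" using \<open>B \<subseteq> V\<close> finite_subset by blast
qed (use assms in \<open>unfold gadget_def, blast+\<close>)

context
  fixes q n1 n2 :: nat and V1 B1 :: "'a set" and E1 and V2 B2 :: "'b set" and E2
  assumes g1: "gadget q n1 V1 E1 B1" and g2: "gadget q n2 V2 E2 B2" and q: "q = n1 + n2 + 1"
begin

lemma tfg_bip: "tfg (V1 <+> V2) (bip E1 B1 E2 B2)"
  unfolding tfg_def
proof (intro conjI)
  have s1: "\<And>u v. E1 u v \<Longrightarrow> u \<in> V1 \<and> v \<in> V1 \<and> u \<noteq> v \<and> E1 v u"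
    and t1: "\<And>u v w. E1 u v \<Longrightarrow> E1 v w \<Longrightarrow> \<not> E1 u w"
    using gadgetD(1)[OF g1] unfolding tfg_def by blast+
  have s2: "\<And>u v. E2 u v \<Longrightarrow> u \<in> V2 \<and> v \<in> V2 \<and> u \<noteq> v \<and> E2 v u"
    and t2: "\<And>u v w. E2 u v \<Longrightarrow> E2 v w \<Longrightarrow> \<not> E2 u w"
    using gadgetD(1)[OF g2] unfolding tfg_def by blast+
  note i1 = gadgetD(6)[OF g1] and i2 = gadgetD(6)[OF g2]
  show "finite (V1 <+> V2)" using gadgetD(2)[OF g1] gadgetD(2)[OF g2] by simp
  show "\<forall>x y. bip E1 B1 E2 B2 x y \<longrightarrow> x \<in> V1 <+> V2 \<and> y \<in> V1 <+> V2 \<and> x \<noteq> y \<and> bip E1 B1 E2 B2 y x"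
  proof (intro allI impI)
    fix x y assume "bip E1 B1 E2 B2 x y"
    then show "x \<in> V1 <+> V2 \<and> y \<in> V1 <+> V2 \<and> x \<noteq> y \<and> bip E1 B1 E2 B2 y x"
      by (cases x; cases y; simp; insert s1 s2 gadgetD(3)[OF g1] gadgetD(3)[OF g2]; blast)
  qed
  show "\<forall>x y z. bip E1 B1 E2 B2 x y \<longrightarrow> bip E1 B1 E2 B2 y z \<longrightarrow> \<not> bip E1 B1 E2 B2 x z"
  proof (intro allI impI notI)
    fix x y z assume "bip E1 B1 E2 B2 x y" "bip E1 B1 E2 B2 y z" "bip E1 B1 E2 B2 x z"
    then show False
      by (cases x; cases y; cases z; simp; insert t1 t2 i1 i2; blast)
  qed
qed

text \<open>The complete join forces disjoint colour sets on \<open>B1\<close> and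
  \<open>B2\<close>, with at least \<open>n1 + 1\<close> and \<open>n2 + 1\<close> members, more
  than \<open>q\<close> in total.\<close>

lemma bip_not_colourable: "\<not> (\<exists>f. proper (V1 <+> V2) (bip E1 B1 E2 B2) q f)"
proof
  assume "\<exists>f. proper (V1 <+> V2) (bip E1 B1 E2 B2) q f"
  then obtain f where f: "proper (V1 <+> V2) (bip E1 B1 E2 B2) q f" by blast
  have bd: "f x < q" if "x \<in> V1 <+> V2" for x using f that unfolding proper_def by blast
  have pr: "f x \<noteq> f y" if "x \<in> V1 <+> V2" "y \<in> V1 <+> V2" "bip E1 B1 E2 B2 x y" for x y
    using f that unfolding proper_def by blast
  have "f (Inl u) \<noteq> f (Inl v)" if "u \<in> V1" "v \<in> V1" "E1 u v" for u v
    using pr[of "Inl u" "Inl v"] that by auto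
  moreover have "f (Inr u) \<noteq> f (Inr v)" if "u \<in> V2" "v \<in> V2" "E2 u v" for u v
    using pr[of "Inr u" "Inr v"] that by auto
  ultimately have "proper V1 E1 q (f \<circ> Inl)" "proper V2 E2 q (f \<circ> Inr)"
    using bd[OF InlI] bd[OF InrI] unfolding proper_def by auto
  then have "n1 < card ((f \<circ> Inl) ` B1)" "n2 < card ((f \<circ> Inr) ` B2)"
    using gadgetD(7)[OF g1] gadgetD(7)[OF g2] by blast+
  moreover have "f (Inl u) \<noteq> f (Inr v)" if "u \<in> B1" "v \<in> B2" for u v
    using pr[of "Inl u" "Inr v"] that gadgetD(3)[OF g1] gadgetD(3)[OF g2] by auto
  then have "(f \<circ> Inl) ` B1 \<inter> (f \<circ> Inr) ` B2 = {}" by auto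
  then have "card ((f \<circ> Inl) ` B1 \<union> (f \<circ> Inr) ` B2) = card ((f \<circ> Inl) ` B1) + card ((f \<circ> Inr) ` B2)"
    using gadgetD(4)[OF g1] gadgetD(4)[OF g2] by (intro card_Un_disjoint) auto
  moreover have "card ((f \<circ> Inl) ` B1 \<union> (f \<circ> Inr) ` B2) \<le> card {..<q}"
    using bd[OF InlI] bd[OF InrI] gadgetD(3)[OF g1] gadgetD(3)[OF g2] by (intro card_mono) auto
  ultimately show False using q by simp
qed

text \<open>Reversal sends colour \<open>n2\<close> to \<open>q - 1 - n2 = n1\<close>. Then
  \<open>B1\<close> uses colours up to \<open>n1\<close>, \<open>B2\<close> uses colours from
  \<open>n1\<close> on, and the only vertices sharing \<open>n1\<close> are \<open>b\<close> and
  \<open>c\<close>, whose edge is missing.\<close>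

lemma bip_critical_cross:
  assumes b: "b \<in> B1" and c: "c \<in> B2"
  shows "\<exists>f. proper (V1 <+> V2) (del (bip E1 B1 E2 B2) {Inl b, Inr c}) q f"
proof -
  obtain f where f: "proper V1 E1 q f" "f b = n1" "\<forall>u\<in>B1 - {b}. f u < n1"
    using gadgetD(8)[OF g1 b] by blast
  obtain g where g: "proper V2 E2 q g" "g c = n2" "\<forall>u\<in>B2 - {c}. g u < n2"
    using gadgetD(8)[OF g2 c] by blast
  have "proper (V1 <+> V2) (del (bip E1 B1 E2 B2) {Inl b, Inr c}) q (case_sum f (\<lambda>u. q - 1 - g u))"
  proof (rule proper_sum[OF f(1) proper_reverse[OF g(1)]])
    fix u v
    assume "del (bip E1 B1 E2 B2) {Inl b, Inr c} (Inl u) (Inr v) \<or>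
      del (bip E1 B1 E2 B2) {Inl b, Inr c} (Inr v) (Inl u)"
    then have uv: "u \<in> B1" "v \<in> B2" "u \<noteq> b \<or> v \<noteq> c" by (auto simp: del_def)
    show "f u \<noteq> q - 1 - g v"
    proof (cases "u = b")
      case True
      then have "g v < n2" using uv g(3) by blast
      then show ?thesis using True f(2) q by simp
    next
      case False
      then have "f u < n1" "g v \<le> n2" using uv f(3) g(2,3) by (blast, metis Diff_iff less_imp_le order_refl singletonD)
      then show ?thesis using q by simp
    qed
  qed (simp_all add: del_def)
  then show ?thesis by blast
qed

text \<open>Tightness keeps \<open>B1\<close> strictly below \<open>n1\<close>, while the reversed
  colouring keeps \<open>B2\<close> at \<open>n1\<close> or above.\<close>

lemma bip_critical_left:
  assumes t: "tight q n1 V1 E1 B1" and uv: "E1 u v"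
  shows "\<exists>f. proper (V1 <+> V2) (del (bip E1 B1 E2 B2) {Inl u, Inl v}) q f"
proof -
  obtain f where f: "proper V1 (del E1 {u, v}) q f" "\<forall>b\<in>B1. f b < n1"
    using t uv unfolding tight_def by blast
  obtain c where "c \<in> B2" using gadgetD(5)[OF g2] by blast
  then obtain g where g: "proper V2 E2 q g" "g c = n2" "\<forall>u\<in>B2 - {c}. g u < n2"
    using gadgetD(8)[OF g2] by blast
  have "proper (V1 <+> V2) (del (bip E1 B1 E2 B2) {Inl u, Inl v}) q (case_sum f (\<lambda>u. q - 1 - g u))"
  proof (rule proper_sum[OF f(1) proper_reverse[OF g(1)]])
    fix x y
    assume "del (bip E1 B1 E2 B2) {Inl u, Inl v} (Inl x) (Inr y) \<or>
      del (bip E1 B1 E2 B2) {Inl u, Inl v} (Inr y) (Inl x)"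
    then have xy: "x \<in> B1" "y \<in> B2" by (auto simp: del_def)
    have "f x < n1" "g y \<le> n2"
      using xy f(2) g(2,3) by (blast, metis Diff_iff less_imp_le order_refl singletonD)
    then show "f x \<noteq> q - 1 - g y" using q by simp
  qed (auto simp: del_def doubleton_eq_iff)
  then show ?thesis by blast
qed

lemma bip_critical_right:
  assumes t: "tight q n2 V2 E2 B2" and uv: "E2 u v"
  shows "\<exists>f. proper (V1 <+> V2) (del (bip E1 B1 E2 B2) {Inr u, Inr v}) q f"
proof -
  obtain g where g: "proper V2 (del E2 {u, v}) q g" "\<forall>b\<in>B2. g b < n2"
    using t uv unfolding tight_def by blast
  obtain c where "c \<in> B1" using gadgetD(5)[OF g1] by blast
  then obtain f where f: "proper V1 E1 q f" "f c = n1" "\<forall>u\<in>B1 - {c}. f u < n1"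
    using gadgetD(8)[OF g1] by blast
  have "proper (V1 <+> V2) (del (bip E1 B1 E2 B2) {Inr u, Inr v}) q (case_sum f (\<lambda>u. q - 1 - g u))"
  proof (rule proper_sum[OF f(1) proper_reverse[OF g(1)]])
    fix x y
    assume "del (bip E1 B1 E2 B2) {Inr u, Inr v} (Inl x) (Inr y) \<or>
      del (bip E1 B1 E2 B2) {Inr u, Inr v} (Inr y) (Inl x)"
    then have xy: "x \<in> B1" "y \<in> B2" by (auto simp: del_def)
    have "g y < n2" "f x \<le> n1"
      using xy g(2) f(2,3) by (blast, metis Diff_iff less_imp_le order_refl singletonD)
    then show "f x \<noteq> q - 1 - g y" using q by simp
  qed (auto simp: del_def doubleton_eq_iff)
  then show ?thesis by blast
qed

text \<open>Needed for Toft's graph, which must be edge-critical to serve again as the matched graph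
  when \<open>k = 5\<close>.\<close>

lemma ecrit_bip:
  assumes t1: "tight q n1 V1 E1 B1" and t2: "tight q n2 V2 E2 B2"
  shows "ecrit q (V1 <+> V2) (bip E1 B1 E2 B2)"
  unfolding ecrit_def
proof (intro conjI allI impI ballI)
  fix x y assume xy: "bip E1 B1 E2 B2 x y"
  show "\<exists>f. proper (V1 <+> V2) (del (bip E1 B1 E2 B2) {x, y}) q f"
  proof (cases x; cases y)
    fix u v assume "x = Inl u" "y = Inl v"
    then show ?thesis using xy bip_critical_left[OF t1] by simp
  next
    fix u v assume "x = Inr u" "y = Inr v"
    then show ?thesis using xy bip_critical_right[OF t2] by simp
  next
    fix u v assume "x = Inl u" "y = Inr v"
    then show ?thesis using xy bip_critical_cross by simp
  next
    fix u v assume "x = Inr v" "y = Inl u"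
    then show ?thesis using xy bip_critical_cross by (simp add: insert_commute)
  qed
next
  fix x assume "x \<in> V1 <+> V2"
  then consider u where "x = Inl u" "u \<in> V1" | u where "x = Inr u" "u \<in> V2" by blast
  then show "\<exists>y. bip E1 B1 E2 B2 x y"
  proof cases
    case 1
    then obtain v where "E1 u v" using t1 unfolding tight_def by blast
    then show ?thesis using 1 by (intro exI[of _ "Inl v"]) simp
  next
    case 2
    then obtain v where "E2 u v" using t2 unfolding tight_def by blast
    then show ?thesis using 2 by (intro exI[of _ "Inr v"]) simp
  qed
qed (use tfg_bip bip_not_colourable in blast)+

end

lemma card_cross_edges:
  "card ((\<lambda>(b, c). {Inl b, Inr c}) ` (B1 \<times> B2)) = card B1 * card B2"
proof -
  have "inj_on (\<lambda>(b, c). {Inl b, Inr c}) (B1 \<times> B2)"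
    by (auto simp: inj_on_def doubleton_eq_iff)
  then show ?thesis by (simp add: card_image card_cartesian_product)
qed

section \<open>Critical subgraphs\<close>

lemma colorable_iff:
  "colorable (W, M) q \<longleftrightarrow>
    (\<exists>f. (\<forall>v\<in>W. f v < q) \<and> (\<forall>u v. {u, v} \<in> M \<longrightarrow> u \<noteq> v \<longrightarrow> f u \<noteq> (f v :: nat)))"
  unfolding colorable_def verts_def edges_def by simp

lemma colorable_mono:
  assumes "colorable (W, M) q" "M' \<subseteq> M" "q \<le> q'"
  shows "colorable (W, M') q'"
  using assms unfolding colorable_iff by (meson order_less_le_trans subsetD)

text \<open>A minimal edge set without a \<open>q\<close>-colouring contains each edge of
  \<open>X\<close>, since the whole graph without that edge is \<open>q\<close>-colourable. Only
  edges are discarded, so the order remains exactly \<open>card V\<close>.\<close>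

lemma critical_subgraph:
  fixes V :: "'a set"
  assumes tf: "tfg V E" and nc: "\<not> (\<exists>f. proper V E q f)" and q: "q \<ge> 1"
    and X: "\<And>e. e \<in> X \<Longrightarrow> \<exists>u v. e = {u, v} \<and> E u v \<and> (\<exists>f. proper V (del E {u, v}) q f)"
  shows "\<exists>G. simple_graph G \<and> k_critical G (Suc q) \<and> triangle_free G \<and>
    card (verts G) = card V \<and> card X \<le> card (edges G)"
proof -
  have fin: "finite V" and sym: "\<And>u v. E u v \<Longrightarrow> u \<in> V \<and> v \<in> V \<and> u \<noteq> v \<and> E v u"
    and tri: "\<And>u v w. E u v \<Longrightarrow> E v w \<Longrightarrow> \<not> E u w"
    using tf unfolding tfg_def by blast+
  obtain h where "bij_betw h V {0..<card V}" using fin ex_bij_betw_finite_nat by blast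
  then have inj: "inj_on h V" by (simp add: bij_betw_def)
  define W where "W = h ` V"
  define A where "A = {{h u, h v} | u v. E u v}"
  have "A \<subseteq> Pow W" unfolding A_def W_def using sym by blast
  then have finA: "finite A" using fin finite_subset unfolding W_def by blast
  have "\<not> colorable (W, A) q"
  proof
    assume "colorable (W, A) q"
    then obtain f where f: "\<forall>v\<in>W. f v < q" "\<And>u v. {u, v} \<in> A \<Longrightarrow> u \<noteq> v \<Longrightarrow> f u \<noteq> f v"
      unfolding colorable_iff by blast
    have "f (h u) \<noteq> f (h v)" if "E u v" for u v
    proof (rule f(2))
      show "{h u, h v} \<in> A" using that unfolding A_def by blast
      show "h u \<noteq> h v" using sym[OF that] inj by (metis inj_onD)
    qed
    then have "proper V E q (f \<circ> h)" using f(1) unfolding proper_def W_def by simp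
    then show False using nc by blast
  qed
  moreover define \<S> where "\<S> = {M. M \<subseteq> A \<and> \<not> colorable (W, M) q}"
  ultimately have "A \<in> \<S>" "finite \<S>" using finA by simp_all
  then obtain M where "M \<in> \<S>" and M_min: "\<forall>M'\<in>\<S>. M' \<subseteq> M \<longrightarrow> M = M'"
    using finite_has_minimal[of \<S>] by blast
  then have M: "M \<subseteq> A" "\<not> colorable (W, M) q" unfolding \<S>_def by blast+
  have min: "M' = M" if "M' \<subseteq> M" "\<not> colorable (W, M') q" for M'
    using M_min M(1) that unfolding \<S>_def by blast
  have finM: "finite M" using M finA finite_subset by blast
  have XM: "h ` e \<in> M" if e: "e \<in> X" for e
  proof (rule ccontr)
    assume nM: "h ` e \<notin> M"
    obtain u v f where uv: "e = {u, v}" "E u v" and f: "proper V (del E {u, v}) q f"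
      using X[OF e] by blast
    have "colorable (W, M) q"
      unfolding colorable_iff
    proof (intro exI[of _ "f \<circ> inv_into V h"] conjI ballI allI impI)
      fix w assume "w \<in> W"
      then show "(f \<circ> inv_into V h) w < q"
        using f inj unfolding W_def proper_def by auto
    next
      fix x y assume xy: "{x, y} \<in> M" "x \<noteq> y"
      then obtain u' v' where u'v': "{x, y} = {h u', h v'}" "E u' v'" using M(1) unfolding A_def by blast
      have "{u', v'} \<noteq> {u, v}"
        using nM xy u'v' uv by (metis image_empty image_insert)
      then have "f u' \<noteq> f v'" using f sym[OF u'v'(2)] u'v'(2) unfolding proper_def del_def by blast
      then show "(f \<circ> inv_into V h) x \<noteq> (f \<circ> inv_into V h) y"
        using u'v'(1) sym[OF u'v'(2)] inj by (auto simp: doubleton_eq_iff)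
    qed
    then show False using M by blast
  qed
  have "inj_on ((`) h) X"
  proof (rule inj_on_subset)
    show "inj_on ((`) h) (Pow V)" using inj by (rule inj_on_image_Pow)
    show "X \<subseteq> Pow V" using X sym by blast
  qed
  then have cardX: "card X \<le> card M"
    using XM finM by (metis card_image card_mono image_subsetI)
  have del_col: "colorable (W, M - {e}) q" if "e \<in> M" for e
    using min[of "M - {e}"] that by blast
  have "M \<noteq> {}"
  proof
    assume "M = {}"
    then have "colorable (W, M) q" using q
      unfolding colorable_iff by (intro exI[of _ "\<lambda>_. 0"]) simp
    then show False using M by blast
  qed
  then obtain e where e: "e \<in> M" by blast
  then obtain a b where ab: "e = {a, b}" using M unfolding A_def by blast
  obtain f where f: "\<forall>v\<in>W. f v < q" "\<And>u v. {u, v} \<in> M - {e} \<Longrightarrow> u \<noteq> v \<Longrightarrow> f u \<noteq> f v"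
    using del_col[OF e] unfolding colorable_iff by blast
  \<comment> \<open>By minimality \<open>M - {e}\<close> has a \<open>q\<close>-colouring; giving
    the end \<open>a\<close> of \<open>e\<close> the new colour \<open>q\<close> repairs
    \<open>e\<close> as well.\<close>
  have "colorable (W, M) (Suc q)"
    unfolding colorable_iff
  proof (intro exI[of _ "f(a := q)"] conjI ballI allI impI)
    fix w assume "w \<in> W"
    then show "(f(a := q)) w < Suc q" using f(1) by (simp add: less_SucI)
  next
    fix x y assume xy: "{x, y} \<in> M" "x \<noteq> y"
    have "x \<in> W" "y \<in> W" using xy M(1) \<open>A \<subseteq> Pow W\<close> by blast+
    then have "f x < q" "f y < q" using f(1) by blast+
    then show "(f(a := q)) x \<noteq> (f(a := q)) y"
    proof (cases "x = a \<or> y = a")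
      case False
      then have "{x, y} \<noteq> e" using ab by blast
      then show ?thesis using f(2)[of x y] xy False by simp
    qed (use xy in auto)
  qed
  then have "chromatic_number (W, M) = Suc q"
    unfolding chromatic_number_def
  proof (rule Least_equality)
    fix k assume "colorable (W, M) k"
    then show "Suc q \<le> k" using M(2) colorable_mono[of W M k M q] by (meson not_less_eq_eq order_refl)
  qed
  then have "k_critical (W, M) (Suc q)"
    using del_col unfolding k_critical_def delete_edge_def verts_def edges_def by simp
  moreover have "simple_graph (W, M)"
    unfolding simple_graph_def verts_def edges_def fst_conv snd_conv
  proof (intro conjI ballI)
    show "finite W" using fin unfolding W_def by simp
    fix d assume "d \<in> M"
    then obtain u v where uv: "d = {h u, h v}" "E u v" using M unfolding A_def by blast
    have "h u \<noteq> h v" using sym[OF uv(2)] inj by (metis inj_onD)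
    then show "\<exists>u v. d = {u, v} \<and> u \<noteq> v \<and> u \<in> W \<and> v \<in> W"
      using uv sym[OF uv(2)] unfolding W_def by blast
  qed
  moreover have "triangle_free (W, M)"
    unfolding odd_girth_gt_def
  proof (intro allI impI)
    fix vs assume vs: "is_cycle (W, M) vs \<and> odd (length vs)"
    show "3 < length vs"
    proof (rule ccontr)
      assume "\<not> 3 < length vs"
      then have len: "length vs = 3" using vs unfolding is_cycle_def by simp
      have edge: "{vs ! i, vs ! ((i + 1) mod 3)} \<in> M" if "i < 3" for i
        using vs that len unfolding is_cycle_def edges_def by simp
      have E: "E u v" if "{h u, h v} \<in> M" "u \<in> V" "v \<in> V" for u v
      proof -
        have "{h u, h v} \<in> A" using that(1) M(1) by (rule rev_subsetD)
        then obtain u' v' where u'v': "{h u, h v} = {h u', h v'}" "E u' v'"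
          unfolding A_def by (elim CollectE exE conjE)
        have "u = u' \<and> v = v' \<or> u = v' \<and> v = u'"
          using u'v'(1) sym[OF u'v'(2)] that(2,3) inj_onD[OF inj] unfolding doubleton_eq_iff by blast
        then show ?thesis using sym[OF u'v'(2)] u'v'(2) by blast
      qed
      have "vs ! 0 \<in> W" "vs ! 1 \<in> W" "vs ! 2 \<in> W"
        using vs len unfolding is_cycle_def verts_def by (auto simp: subset_eq)
      then obtain x y z where xyz: "vs ! 0 = h x" "vs ! 1 = h y" "vs ! 2 = h z" "x \<in> V" "y \<in> V" "z \<in> V"
        unfolding W_def by blast
      have "E x y" "E y z" "E z x"
        using edge[of 0] edge[of 1] edge[of 2] xyz E by (simp_all add: numeral_2_eq_2)
      then show False using tri sym by blast
    qed
  qed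
  moreover have "card W = card V" unfolding W_def using inj by (rule card_image)
  ultimately show ?thesis
    using cardX by (intro exI[of _ "(W, M)"]) (simp add: verts_def edges_def)
qed

text \<open>\<open>X1\<close> collects inner edges of the first side that are to be counted besides
  the join; it may be empty when that side is not tight.\<close>

lemma critical_of_gadgets:
  assumes g1: "gadget q n1 V1 E1 B1" and g2: "gadget q n2 V2 E2 B2" and q: "q = n1 + n2 + 1"
    and X1: "X1 \<subseteq> {{u, v} | u v. E1 u v}" "X1 = {} \<or> tight q n1 V1 E1 B1"
  shows "\<exists>G. simple_graph G \<and> k_critical G (Suc q) \<and> triangle_free G \<and>
    card (verts G) = card V1 + card V2 \<and> card B1 * card B2 + card X1 \<le> card (edges G)"
proof -
  define C :: "('a + 'b) set set" where "C = (\<lambda>(b, c). {Inl b, Inr c}) ` (B1 \<times> B2)"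
  define L :: "('a + 'b) set set" where "L = (\<lambda>e. Inl ` e) ` X1"
  have "X1 \<subseteq> Pow V1" using X1(1) tfgD[OF gadgetD(1)[OF g1]] by blast
  then have "finite X1" using gadgetD(2)[OF g1] finite_subset by blast
  moreover have "C \<inter> L = {}" unfolding C_def L_def by auto
  ultimately have "card (C \<union> L) = card C + card L"
    using gadgetD(4)[OF g1] gadgetD(4)[OF g2] unfolding C_def L_def by (intro card_Un_disjoint) auto
  moreover have "card L = card X1"
    unfolding L_def by (intro card_image inj_onI) (metis inj_Inl inj_image_eq_iff)
  ultimately have card: "card (C \<union> L) = card B1 * card B2 + card X1"
    unfolding C_def card_cross_edges by simp
  have "\<exists>G. simple_graph G \<and> k_critical G (Suc q) \<and> triangle_free G \<and>
    card (verts G) = card (V1 <+> V2) \<and> card (C \<union> L) \<le> card (edges G)"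
  proof (rule critical_subgraph[OF tfg_bip[OF g1 g2 q] bip_not_colourable[OF g1 g2 q]])
    show "1 \<le> q" using q by simp
    fix e assume "e \<in> C \<union> L"
    then show "\<exists>u v. e = {u, v} \<and> bip E1 B1 E2 B2 u v \<and>
        (\<exists>f. proper (V1 <+> V2) (del (bip E1 B1 E2 B2) {u, v}) q f)"
    proof
      assume "e \<in> C"
      then obtain b c where "e = {Inl b, Inr c}" "b \<in> B1" "c \<in> B2" unfolding C_def by auto
      then show ?thesis using bip_critical_cross[OF g1 g2 q]
        by (intro exI[of _ "Inl b"] exI[of _ "Inr c"]) simp
    next
      assume "e \<in> L"
      then obtain d where d: "d \<in> X1" "e = Inl ` d" unfolding L_def by blast
      then obtain u v where uv: "d = {u, v}" "E1 u v" using X1(1) by blast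
      have "tight q n1 V1 E1 B1" using X1(2) d by blast
      then show ?thesis using bip_critical_left[OF g1 g2 q] uv d
        by (intro exI[of _ "Inl u"] exI[of _ "Inl v"]) simp
    qed
  qed
  then show ?thesis
    using gadgetD(2)[OF g1] gadgetD(2)[OF g2] card by (simp add: card_Plus)
qed


section \<open>Mantel's bound\<close>

text \<open>The neighbourhood of a vertex \<open>v\<close> of maximum degree \<open>d\<close> is
  independent, so every edge has an end outside it. Summing degrees over those \<open>n - d\<close>
  vertices gives at most \<open>(n - d) * d\<close> edges.\<close>

lemma mantel:
  assumes sg: "simple_graph G" and tf: "triangle_free G"
  shows "4 * card (edges G) \<le> (card (verts G))\<^sup>2"
proof (cases "verts G = {}")
  case True
  then have "edges G = {}" using sg unfolding simple_graph_def by blast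
  then show ?thesis by simp
next
  case False
  define W where "W = verts G"
  define nb where "nb u = {w \<in> W. u \<noteq> w \<and> {u, w} \<in> edges G}" for u
  have fin: "finite W" using sg unfolding simple_graph_def W_def by blast
  have edge: "\<exists>u v. e = {u, v} \<and> u \<noteq> v \<and> u \<in> W \<and> v \<in> W" if "e \<in> edges G" for e
    using sg that unfolding simple_graph_def W_def by blast
  have finnb: "finite (nb u)" for u using fin unfolding nb_def by simp
  have "Max ((\<lambda>u. card (nb u)) ` W) \<in> (\<lambda>u. card (nb u)) ` W"
    using fin False by (intro Max_in) (auto simp: W_def)
  then obtain v where "v \<in> W" "Max ((\<lambda>u. card (nb u)) ` W) = card (nb v)" by blast
  then have v: "v \<in> W" "\<And>u. u \<in> W \<Longrightarrow> card (nb u) \<le> card (nb v)"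
    using fin by (simp, metis Max_ge finite_imageI imageI)
  have indep: "{u, w} \<notin> edges G" if u: "u \<in> nb v" "w \<in> nb v" "u \<noteq> w" for u w
  proof
    assume uw: "{u, w} \<in> edges G"
    have "is_cycle G [v, u, w]"
      unfolding is_cycle_def
    proof (intro conjI allI impI)
      have vu: "v \<noteq> u" "v \<noteq> w" "u \<in> W" "w \<in> W" "{v, u} \<in> edges G" "{w, v} \<in> edges G"
        using u unfolding nb_def by (simp_all add: insert_commute)
      then show "distinct [v, u, w]" "set [v, u, w] \<subseteq> verts G" using u(3) v(1) by (simp_all add: W_def)
      fix i assume "i < length [v, u, w]"
      then consider "i = 0" | "i = 1" | "i = 2" by fastforce
      then show "{[v, u, w] ! i, [v, u, w] ! ((i + 1) mod length [v, u, w])} \<in> edges G"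
        using vu uw by cases simp_all
    qed simp
    then show False using tf unfolding odd_girth_gt_def by fastforce
  qed
  have "edges G \<subseteq> (\<Union>u\<in>W - nb v. (\<lambda>w. {u, w}) ` nb u)"
  proof
    fix e assume e: "e \<in> edges G"
    then obtain a b where ab: "e = {a, b}" "a \<noteq> b" "a \<in> W" "b \<in> W" using edge by blast
    then have "b \<in> nb a" "a \<in> nb b" using e by (auto simp: nb_def insert_commute)
    moreover have "a \<notin> nb v \<or> b \<notin> nb v" using indep ab e by blast
    ultimately show "e \<in> (\<Union>u\<in>W - nb v. (\<lambda>w. {u, w}) ` nb u)"
      using ab by (auto simp: insert_commute)
  qed
  then have "card (edges G) \<le> card (\<Union>u\<in>W - nb v. (\<lambda>w. {u, w}) ` nb u)"
    using fin finnb by (intro card_mono) auto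
  also have "\<dots> \<le> (\<Sum>u\<in>W - nb v. card ((\<lambda>w. {u, w}) ` nb u))"
    using fin by (intro card_UN_le) simp
  also have "\<dots> \<le> (\<Sum>u\<in>W - nb v. card (nb v))"
  proof (rule sum_mono)
    fix u assume "u \<in> W - nb v"
    then have "card (nb u) \<le> card (nb v)" using v(2) by blast
    then show "card ((\<lambda>w. {u, w}) ` nb u) \<le> card (nb v)" by (rule le_trans[OF card_image_le[OF finnb]])
  qed
  also have "\<dots> = (card W - card (nb v)) * card (nb v)"
    using fin finnb by (simp add: card_Diff_subset nb_def)
  finally have le: "card (edges G) \<le> (card W - card (nb v)) * card (nb v)" .
  have "4 * ((a - b) * b) \<le> a\<^sup>2" if ba: "b \<le> a" for a b :: nat
  proof -
    obtain d where "a = b + d" using le_Suc_ex[OF ba] by blast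
    moreover have "4 * (real d * real b) \<le> (real b + real d)\<^sup>2"
      using sum_squares_bound[of "real d" "real b"] by (simp add: power2_eq_square algebra_simps)
    then have "4 * (d * b) \<le> (b + d)\<^sup>2"
      by (metis of_nat_add of_nat_le_iff of_nat_mult of_nat_numeral of_nat_power)
    ultimately show ?thesis by simp
  qed
  moreover have "card (nb v) \<le> card W" using fin by (intro card_mono) (auto simp: nb_def)
  ultimately show ?thesis using le unfolding W_def by (meson le_trans mult_le_mono2)
qed

section \<open>Densities\<close>

definition dense_critical :: "nat \<Rightarrow> real \<Rightarrow> bool" where
  "dense_critical k c \<longleftrightarrow> (\<forall>N. \<exists>G. simple_graph G \<and> k_critical G k \<and> triangle_free G \<and>
     card (verts G) \<ge> N \<and> real (card (edges G)) > c * (real (card (verts G)))\<^sup>2)"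

lemma dense_critical_mono:
  assumes "dense_critical k c" "c' \<le> c"
  shows "dense_critical k c'"
proof -
  have "c' * (real n)\<^sup>2 \<le> c * (real n)\<^sup>2" for n using assms(2) by (intro mult_right_mono) auto
  then show ?thesis using assms(1) unfolding dense_critical_def by (meson le_less_trans)
qed

lemma dense_critical_less: "dense_critical k c \<Longrightarrow> c < 1 / 4"
proof -
  assume "dense_critical k c"
  then obtain G where G: "simple_graph G" "triangle_free G" "card (verts G) \<ge> 1"
    "real (card (edges G)) > c * (real (card (verts G)))\<^sup>2" unfolding dense_critical_def by blast
  have "real (4 * card (edges G)) \<le> real ((card (verts G))\<^sup>2)"
    using mantel[OF G(1,2)] of_nat_le_iff by blast
  then have "c * (real (card (verts G)))\<^sup>2 < 1 / 4 * (real (card (verts G)))\<^sup>2" using G(4) by simp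
  then show "c < 1 / 4" using G(3) by (simp add: mult_less_cancel_right)
qed

lemma density_constant_alt: "density_constant 3 k = Sup {c. dense_critical k c}"
  unfolding density_constant_def dense_critical_def by simp

text \<open>\<open>Sup\<close> on the reals is informative only for sets bounded above, so Mantel's
  bound enters the lower estimates too.\<close>

lemma density_constant_ge:
  assumes "\<And>c. c < d \<Longrightarrow> dense_critical k c"
  shows "d \<le> density_constant 3 k"
proof (rule dense_le)
  fix c assume "c < d"
  moreover have "bdd_above {c. dense_critical k c}"
    using dense_critical_less by (intro bdd_aboveI[of _ "1 / 4"]) force
  ultimately show "c \<le> density_constant 3 k"
    unfolding density_constant_alt using assms by (intro cSup_upper) auto
qed

lemma density_constant_le:
  assumes "dense_critical k c"
  shows "density_constant 3 k \<le> 1 / 4"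
  unfolding density_constant_alt
  by (rule cSup_least) (use assms dense_critical_less in \<open>blast, simp add: less_imp_le\<close>)

text \<open>Toft's graph: two odd cycles of length \<open>m\<close>, matched to the two sides of a complete
  bipartite graph.\<close>

lemma ex_toft:
  assumes m: "odd m" "m \<ge> 5"
  shows "\<exists>(V :: (nat \<times> bool + nat \<times> bool) set) E. ecrit 3 V E \<and> card V = 4 * m \<and>
    m\<^sup>2 \<le> card {{u, v} | u v. E u v}"
proof -
  let ?V = "{..<m} \<times> (UNIV :: bool set)" and ?E = "pend {..<m} (cyc m)" and ?B = "{..<m} \<times> {True}"
  have g: "gadget 3 1 ?V ?E ?B" and t: "tight 3 1 ?V ?E ?B"
    using gadget_pend[OF ecrit_imp_vcrit[OF ecrit_cyc[OF m]]] tight_pend[OF ecrit_cyc[OF m]]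
    by (simp_all add: numeral_3_eq_3 numeral_2_eq_2)
  let ?W = "?V <+> ?V" and ?F = "bip ?E ?B ?E ?B"
  have e: "ecrit 3 ?W ?F" by (rule ecrit_bip[OF g g _ t t]) simp
  have "(\<lambda>(b, c). {Inl b, Inr c}) ` (?B \<times> ?B) \<subseteq> {{u, v} | u v. ?F u v}" by fastforce
  moreover have "{{u, v} | u v. ?F u v} \<subseteq> Pow ?W"
    using tfgD[of ?W ?F] e unfolding ecrit_def by blast
  then have "finite {{u, v} | u v. ?F u v}" by (rule finite_subset) simp
  ultimately have "card ((\<lambda>(b, c). {Inl b, Inr c :: nat \<times> bool + nat \<times> bool}) ` (?B \<times> ?B)) \<le> card {{u, v} | u v. ?F u v}"
    by (intro card_mono)
  then have "m\<^sup>2 \<le> card {{u, v} | u v. ?F u v}"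
    unfolding card_cross_edges by (simp add: card_cartesian_product power2_eq_square)
  moreover have "card ?W = 4 * m" by (simp add: card_Plus card_cartesian_product)
  ultimately show ?thesis using e by blast
qed

text \<open>The join alone has \<open>m^2\<close> edges on \<open>4 * m\<close> vertices, and
  \<open>m^2 / (4 * m)^2 = 1 / 16\<close>.\<close>

lemma dense_critical_4:
  assumes c: "c < 1 / 16"
  shows "dense_critical 4 c"
  unfolding dense_critical_def
proof
  fix N :: nat
  define m where "m = 2 * N + 5"
  have "odd m" "m \<ge> 5" by (simp_all add: m_def)
  then obtain V :: "(nat \<times> bool + nat \<times> bool) set" and E where
    VE: "ecrit 3 V E" "card V = 4 * m" "m\<^sup>2 \<le> card {{u, v} | u v. E u v}" using ex_toft by blast
  have "\<exists>G. simple_graph G \<and> k_critical G (Suc 3) \<and> triangle_free G \<and>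
    card (verts G) = card V \<and> card {{u, v} | u v. E u v} \<le> card (edges G)"
  proof (rule critical_subgraph)
    show "tfg V E" "\<not> (\<exists>f. proper V E 3 f)" using VE(1) unfolding ecrit_def by blast+
    fix e assume "e \<in> {{u, v} | u v. E u v}"
    then obtain u v where "e = {u, v}" "E u v" by blast
    moreover from this have "\<exists>f. proper V (del E {u, v}) 3 f" using VE(1) unfolding ecrit_def by blast
    ultimately show "\<exists>u v. e = {u, v} \<and> E u v \<and> (\<exists>f. proper V (del E {u, v}) 3 f)" by blast
  qed simp
  then obtain G where G: "simple_graph G" "k_critical G (Suc 3)" "triangle_free G"
    "card (verts G) = card V" "card {{u, v} | u v. E u v} \<le> card (edges G)" by blast
  have "c * (real (4 * m))\<^sup>2 < 1 / 16 * (real (4 * m))\<^sup>2"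
    using c by (intro mult_strict_right_mono) (simp_all add: m_def)
  also have "\<dots> = real (m\<^sup>2)" by (simp add: power2_eq_square)
  also have "\<dots> \<le> real (card (edges G))" using G(5) VE(3) by simp
  finally have "c * (real (card (verts G)))\<^sup>2 < real (card (edges G))" using G(4) VE(2) by simp
  moreover have "N \<le> card (verts G)" using G(4) VE(2) by (simp add: m_def)
  ultimately show "\<exists>G. simple_graph G \<and> k_critical G 4 \<and> triangle_free G \<and> N \<le> card (verts G) \<and>
      c * (real (card (verts G)))\<^sup>2 < real (card (edges G))"
    using G by (intro exI[of _ G]) simp
qed

section \<open>Sizes of products, and density for chromatic number five\<close>

lemma card_prodg:
  assumes "\<And>i. i < n \<Longrightarrow> finite (V i)"
  shows "card (prodg_top n V) = (\<Prod>i<n. card (V i))"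
    and "card (prodg_base n V \<union> prodg_top n V) = (\<Sum>i<n. card (V i)) + (\<Prod>i<n. card (V i))"
proof -
  have t: "card (prodg_top n V) = (\<Prod>i<n. card (V i))"
    unfolding prodg_top_def by (simp add: card_image card_PiE)
  have b: "card (prodg_base n V) = (\<Sum>i<n. card (V i))"
    unfolding prodg_base_def using assms by (simp add: card_image card_SigmaI)
  show "card (prodg_top n V) = (\<Prod>i<n. card (V i))" by (rule t)
  have "finite (prodg_base n V)" "finite (prodg_top n V)" "prodg_base n V \<inter> prodg_top n V = {}"
    unfolding prodg_base_def prodg_top_def using assms by (auto intro!: finite_PiE)
  then show "card (prodg_base n V \<union> prodg_top n V) = (\<Sum>i<n. card (V i)) + (\<Prod>i<n. card (V i))"
    using t b by (simp add: card_Un_disjoint)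
qed

text \<open>With \<open>a = |A|\<close> and \<open>b\<close> the size of the larger side, a graph built on a Toft graph \<open>A\<close> has about
  \<open>2 a + b\<close> vertices and \<open>a b + a\<^sup>2 / 16\<close> edges; the optimal ratio is \<open>a : b = 8 : 15\<close>.\<close>

lemma ex_critical_5:
  assumes x: "odd x" "x \<ge> 5"
  shows "\<exists>G. simple_graph G \<and> k_critical G 5 \<and> triangle_free G \<and>
    card (verts G) = 124 * x\<^sup>2 + 19 * x + 8 \<and> 1984 * x ^ 4 \<le> card (edges G)"
proof -
  \<comment> \<open>The Toft graph has \<open>4 * m\<close>, about \<open>32 * x\<^sup>2\<close>,
    vertices, against \<open>4 * x * (15 * x) = 60 * x\<^sup>2\<close> tuples, in ratio 8 : 15. The
    added 1 makes \<open>m\<close> odd.\<close>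
  define m where "m = 8 * x\<^sup>2 + 1"
  have "x \<le> x\<^sup>2" using x by (simp add: power2_eq_square)
  then have "odd m" "m \<ge> 5" using x by (auto simp: m_def)
  then obtain A :: "(nat \<times> bool + nat \<times> bool) set" and E where
    A: "ecrit 3 A E" "card A = 4 * m" "m\<^sup>2 \<le> card {{u, v} | u v. E u v}" using ex_toft by blast
  have finA: "finite A" using A(1) unfolding ecrit_def tfg_def by blast
  obtain T :: "(nat \<times> bool + nat \<times> bool) set" and ET where
    T: "ecrit 3 T ET" "card T = 4 * x" using ex_toft[OF x] by blast
  obtain S :: "nat set" and ES where S: "vcrit 3 S ES" "card S = 4 * x"
    using vcrit_to_nat[OF ecrit_imp_vcrit[OF T(1)]] T(2) by metis
  have x15: "odd (15 * x)" "15 * x \<ge> 5" using x by auto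
  have C: "vcrit 2 {..<15 * x} (cyc (15 * x))" by (rule ecrit_imp_vcrit[OF ecrit_cyc[OF x15]])
  define V where "V i = (if i = 0 then S else {..<15 * x})" for i :: nat
  define F where "F i = (if i = 0 then ES else cyc (15 * x))" for i :: nat
  have vc: "vcrit (4 - 1 - i) (V i) (F i)" if "i < 2" for i
    using S C that by (cases "i = 0") (simp_all add: V_def F_def numeral_2_eq_2 less_Suc_eq)
  have finV: "finite (V i)" if "i < 2" for i using vc[OF that] unfolding vcrit_def tfg_def by blast
  have cards: "card (prodg_top 2 V) = 60 * x\<^sup>2"
    "card (prodg_base 2 V \<union> prodg_top 2 V) = 19 * x + 60 * x\<^sup>2"
    using card_prodg[of 2 V, OF finV] S(2)
    by (simp_all add: numeral_2_eq_2 V_def power2_eq_square algebra_simps)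
  have g1: "gadget 4 1 (A \<times> UNIV) (pend A E) (A \<times> {True})"
    using gadget_pend[OF ecrit_imp_vcrit[OF A(1)]] by simp
  have t1: "tight 4 1 (A \<times> UNIV) (pend A E) (A \<times> {True})" using tight_pend[OF A(1)] by simp
  have g2: "gadget 4 2 (prodg_base 2 V \<union> prodg_top 2 V) (prodg 2 V F) (prodg_top 2 V)"
    by (rule gadget_prodg[OF vc]) simp_all
  let ?X = "{{u, v} | u v. pend A E u v}"
  \<comment> \<open>The edges of the Toft graph reappear in the gadget, contributing
    \<open>m\<^sup>2\<close> edges beyond those of the join.\<close>
  have "(\<lambda>e. (\<lambda>u. (u, False)) ` e) ` {{u, v} | u v. E u v} \<subseteq> ?X"
  proof
    fix d assume "d \<in> (\<lambda>e. (\<lambda>u. (u, False)) ` e) ` {{u, v} | u v. E u v}"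
    then obtain u v where "d = (\<lambda>u. (u, False)) ` {u, v}" "E u v" by blast
    then have "d = {(u, False), (v, False)}" "pend A E (u, False) (v, False)" by (simp_all add: pend_def)
    then show "d \<in> ?X" by blast
  qed
  moreover have "?X \<subseteq> Pow (A \<times> UNIV)" using tfgD[OF gadgetD(1)[OF g1]] by blast
  then have "finite ?X" by (rule finite_subset) (simp add: finA)
  ultimately have "card ((\<lambda>e. (\<lambda>u. (u, False)) ` e) ` {{u, v} | u v. E u v}) \<le> card ?X"
    by (intro card_mono)
  moreover have "inj (\<lambda>u :: nat \<times> bool + nat \<times> bool. (u, False))" by (auto simp: inj_def)
  then have "inj_on (\<lambda>e. (\<lambda>u. (u, False)) ` e) {{u, v} | u v. E u v}"
    by (intro inj_onI) (metis inj_image_eq_iff)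
  ultimately have X: "m\<^sup>2 \<le> card ?X" using A(3) by (simp add: card_image)
  have "\<exists>G. simple_graph G \<and> k_critical G (Suc 4) \<and> triangle_free G \<and>
    card (verts G) = card (A \<times> (UNIV :: bool set)) + card (prodg_base 2 V \<union> prodg_top 2 V) \<and>
    card (A \<times> {True}) * card (prodg_top 2 V) + card ?X \<le> card (edges G)"
    using t1 by (intro critical_of_gadgets[OF g1 g2]) auto
  then obtain G where G: "simple_graph G" "k_critical G (Suc 4)" "triangle_free G"
    "card (verts G) = card (A \<times> (UNIV :: bool set)) + card (prodg_base 2 V \<union> prodg_top 2 V)"
    "card (A \<times> {True}) * card (prodg_top 2 V) + card ?X \<le> card (edges G)" by blast
  have "card (verts G) = 124 * x\<^sup>2 + 19 * x + 8"
    using G(4) A(2) cards by (simp add: card_cartesian_product m_def)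
  moreover have "1984 * x ^ 4 \<le> 4 * m * (60 * x\<^sup>2) + m\<^sup>2"
    by (simp add: m_def power2_eq_square algebra_simps power4_eq_xxxx)
  then have "1984 * x ^ 4 \<le> card (edges G)"
    using G(5) A(2) cards X by (simp add: card_cartesian_product)
  ultimately show ?thesis using G(1-3) by (intro exI[of _ G]) simp
qed

lemma dense_critical_5:
  assumes c: "c < 4 / 31" and c0: "c \<ge> 0"
  shows "dense_critical 5 c"
  unfolding dense_critical_def
proof
  fix N :: nat
  \<comment> \<open>\<open>15376\<close> is \<open>124\<^sup>2\<close>, and \<open>1984\<close> is
    4/31 of it, so \<delta> is the gap between the leading coefficients.\<close>
  define \<delta> where "\<delta> = 1984 - 15376 * c"
  have \<delta>: "\<delta> > 0" using c by (simp add: \<delta>_def)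
  \<comment> \<open>\<open>5360 = 4960 + 400\<close> absorbs the lower terms of
    \<open>(124 * x + 20)\<^sup>2\<close>.\<close>
  obtain x0 :: nat where x0: "5360 / \<delta> < real x0" using reals_Archimedean2 by blast
  define x where "x = 2 * (x0 + N) + 9"
  have x: "odd x" "x \<ge> 8" "x \<ge> x0" "x \<ge> N" by (simp_all add: x_def)
  obtain G where G: "simple_graph G" "k_critical G 5" "triangle_free G"
    "card (verts G) = 124 * x\<^sup>2 + 19 * x + 8" "1984 * x ^ 4 \<le> card (edges G)"
    using ex_critical_5[OF x(1)] x(2) by auto
  have "5360 / \<delta> < real x" using x0 x(3) by simp
  then have "5360 < \<delta> * real x" using \<delta> by (simp add: pos_divide_less_eq mult.commute)
  moreover have "c * 5360 \<le> 5360" using c by simp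
  ultimately have less: "c * (15376 * real x + 5360) < 1984 * real x"
    by (simp add: \<delta>_def algebra_simps)
  \<comment> \<open>\<open>19 * x + 8 \<le> 20 * x\<close> is where \<open>x \<ge> 8\<close>
    enters.\<close>
  have "card (verts G) \<le> x * (124 * x + 20)"
    unfolding G(4) using x(2) by (simp add: power2_eq_square algebra_simps)
  then have "(card (verts G))\<^sup>2 \<le> (x * (124 * x + 20))\<^sup>2" by (rule power_mono) simp
  also have "\<dots> = x\<^sup>2 * (15376 * x\<^sup>2 + 4960 * x + 400)"
    by (simp add: power2_eq_square algebra_simps)
  also have "\<dots> \<le> x\<^sup>2 * (15376 * x\<^sup>2 + 5360 * x)" using x(2) by (intro mult_le_mono2) simp
  also have "\<dots> = x ^ 3 * (15376 * x + 5360)"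
    by (simp add: power2_eq_square power3_eq_cube algebra_simps)
  finally have "real ((card (verts G))\<^sup>2) \<le> real (x ^ 3 * (15376 * x + 5360))"
    using of_nat_le_iff by blast
  then have "c * (real (card (verts G)))\<^sup>2 \<le> c * (real x ^ 3 * (15376 * real x + 5360))"
    using c0 by (intro mult_left_mono) simp_all
  also have "\<dots> = real x ^ 3 * (c * (15376 * real x + 5360))" by simp
  also have "\<dots> < real x ^ 3 * (1984 * real x)" using less x(2) by (intro mult_strict_left_mono) auto
  also have "\<dots> = real (1984 * x ^ 4)" by (simp add: power3_eq_cube power4_eq_xxxx)
  also have "\<dots> \<le> real (card (edges G))" using G(5) of_nat_le_iff by blast
  finally have "c * (real (card (verts G)))\<^sup>2 < real (card (edges G))" .
  moreover have "N \<le> card (verts G)" unfolding G(4) using x(4) by simp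
  ultimately show "\<exists>G. simple_graph G \<and> k_critical G 5 \<and> triangle_free G \<and> N \<le> card (verts G) \<and>
      c * (real (card (verts G)))\<^sup>2 < real (card (edges G))"
    using G by blast
qed

section \<open>Density for chromatic number six and above\<close>

lemma ex_vcrit_large:
  assumes "p \<ge> 2"
  shows "\<exists>(V :: nat set) E. vcrit p V E \<and> card V \<ge> N"
proof -
  obtain p' where "p = 2 + p'" using le_Suc_ex[OF assms] by blast
  then have p': "p = p' + 2" by simp
  obtain V :: "nat set" and E where V: "vcrit p V E" "card V = 2 ^ (p' + 1) * (N + 3) - 1"
    using ex_vcrit[of "N + 3" p'] unfolding p' by auto
  have "1 * (N + 3) \<le> 2 ^ (p' + 1) * (N + 3)" by (rule mult_le_mono1) simp
  moreover have "N \<le> n - 1" if "1 * (N + 3) \<le> n" for n using that by simp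
  ultimately have "N \<le> card V" unfolding V(2) by blast
  then show ?thesis using V by blast
qed

text \<open>The two sides are balanced by tuning the 4-chromatic factor, whose size may be any number
  \<open>4 h - 1\<close>; \<open>M\<close> controls all relative errors.\<close>

lemma ex_critical_balanced:
  assumes k: "k \<ge> 6" and M: "M \<ge> 1"
  shows "\<exists>G b. simple_graph G \<and> k_critical G k \<and> triangle_free G \<and> card (verts G) \<ge> N \<and> b > 0 \<and>
    M * card (verts G) \<le> (2 * M + 4) * b \<and> b * b * (M - 1) \<le> M * card (edges G)"
proof -
  define q where "q = k - 1"
  \<comment> \<open>One side has \<open>n = 2\<close>, so the other has
    \<open>n = q - 3 = r + 1\<close>: there are \<open>r\<close> factors of chromatic number at
    least 5, then the tunable 4-chromatic one. Since \<open>r \<ge> 1\<close>, at least one factor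
    precedes it.\<close>
  define r where "r = k - 5"
  have q: "q = r + 4" "k = Suc q" "r \<ge> 1" using k by (auto simp: q_def r_def)
  have "\<forall>i. \<exists>VE. i < r \<longrightarrow> vcrit (q - 1 - i) (fst VE :: nat set) (snd VE) \<and> card (fst VE) \<ge> M"
  proof
    fix i
    show "\<exists>VE. i < r \<longrightarrow> vcrit (q - 1 - i) (fst VE :: nat set) (snd VE) \<and> card (fst VE) \<ge> M"
      using ex_vcrit_large[of "q - 1 - i" M] q by (cases "i < r") auto
  qed
  from choice[OF this] obtain S where
    S: "\<And>i. i < r \<Longrightarrow> vcrit (q - 1 - i) (fst (S i) :: nat set) (snd (S i))"
       "\<And>i. i < r \<Longrightarrow> M \<le> card (fst (S i))" by blast
  define P where "P = (\<Prod>i<r. card (fst (S i)))"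
  define K where "K = (\<Sum>i<r. card (fst (S i)))"
  have "1 \<le> card (fst (S i))" if "i < r" for i using S(2)[OF that] M by simp
  then have "1 \<le> (\<Prod>i\<in>{..<r} - {0}. card (fst (S i)))" by (intro prod_ge_1) auto
  moreover have "P = card (fst (S 0)) * (\<Prod>i\<in>{..<r} - {0}. card (fst (S i)))"
    unfolding P_def using q by (intro prod.remove) auto
  ultimately have "card (fst (S 0)) * 1 \<le> P" using mult_le_mono2 by metis
  then have MP: "M \<le> P" using S(2)[of 0] q by simp
  \<comment> \<open>The first \<open>r\<close> factors of the second side are fixed before the first
    side is chosen. A product \<open>b \<ge> L\<close> then exceeds each of the error terms
    \<open>M * K\<close>, \<open>4 * P * M\<close> and \<open>11 * P\<close>; the last will give
    \<open>h \<ge> 3\<close>.\<close>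
  define L where "L = M + M * K + 4 * P * M + 11 * P + N + 1"
  obtain T0 :: "nat set" and F0 where T0: "vcrit (q - 1) T0 F0" "L \<le> card T0"
    using ex_vcrit_large[of "q - 1" L] q by auto
  obtain T1 :: "nat set" and F1 where T1: "vcrit (q - 2) T1 F1" "L \<le> card T1"
    using ex_vcrit_large[of "q - 2" L] q by auto
  define b where "b = card T0 * card T1"
  have "L * 1 \<le> b" unfolding b_def using T0(2) T1(2) by (intro mult_le_mono) (auto simp: L_def)
  then have Lb: "L \<le> b" by simp
  have b0: "b > 0" and b11: "11 * P \<le> b" and b4: "4 * P * M \<le> b" and bK: "M * K \<le> b"
    using Lb unfolding L_def by linarith+
  have "M \<le> card T0" "M \<le> card T1" using T0(2) T1(2) unfolding L_def by linarith+
  then have bT: "M * card T0 \<le> b" "M * card T1 \<le> b" unfolding b_def by (simp_all add: mult.commute mult_le_mono)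
  \<comment> \<open>The largest \<open>h\<close> with \<open>P * (4 * h - 1) \<le> b\<close>, so the
    second side falls short of the first by less than \<open>4 * P\<close>.\<close>
  define h where "h = (b + P) div (4 * P)"
  have P0: "P > 0" using MP M by simp
  have "12 * P div (4 * P) \<le> h" unfolding h_def using b11 by (intro div_le_mono) simp
  then have h3: "h \<ge> 3" using P0 by simp
  have h_le: "4 * P * h \<le> b + P" unfolding h_def by (rule times_div_less_eq_dividend)
  have h_gt: "b + P < 4 * P * h + 4 * P"
    unfolding h_def using P0 dividend_less_times_div[of "4 * P" "b + P"] by simp
  obtain R :: "nat set" and FR where R: "vcrit 3 R FR" "card R = 4 * h - 1"
    using ex_vcrit[OF h3, of 1] by (auto simp: numeral_3_eq_3)
  define s where "s = 4 * h - 1"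
  have "4 * h = s + 1" using h3 by (simp add: s_def)
  then have "4 * P * h = P * s + P" by (metis distrib_left mult.assoc mult.commute mult.right_neutral)
  then have sP: "P * s \<le> b" "b \<le> P * s + 4 * P" using h_le h_gt by linarith+
  define V1 where "V1 i = (if i = 0 then T0 else T1)" for i :: nat
  define E1 where "E1 i = (if i = 0 then F0 else F1)" for i :: nat
  define V2 where "V2 i = (if i < r then fst (S i) else R)" for i
  define E2 where "E2 i = (if i < r then snd (S i) else FR)" for i
  have vc1: "vcrit (q - 1 - i) (V1 i) (E1 i)" if "i < 2" for i
    using T0 T1 that by (cases "i = 0") (simp_all add: V1_def E1_def numeral_2_eq_2 less_Suc_eq)
  have vc2: "vcrit (q - 1 - i) (V2 i) (E2 i)" if "i < r + 1" for i
  proof (cases "i < r")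
    case True
    then show ?thesis using S(1) by (simp add: V2_def E2_def)
  next
    case False
    then have "i = r" using that by simp
    then show ?thesis using R(1) q by (simp add: V2_def E2_def)
  qed
  have fin1: "finite (V1 i)" if "i < 2" for i using vc1[OF that] unfolding vcrit_def tfg_def by blast
  have fin2: "finite (V2 i)" if "i < r + 1" for i using vc2[OF that] unfolding vcrit_def tfg_def by blast
  have c1: "card (prodg_top 2 V1) = b"
    "card (prodg_base 2 V1 \<union> prodg_top 2 V1) = card T0 + card T1 + b"
    using card_prodg[of 2 V1, OF fin1] by (simp_all add: numeral_2_eq_2 V1_def b_def)
  have "(\<Prod>i<r + 1. card (V2 i)) = P * s" "(\<Sum>i<r + 1. card (V2 i)) = K + s"
    using R(2) by (simp_all add: V2_def P_def K_def s_def)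
  then have c2: "card (prodg_top (r + 1) V2) = P * s"
    "card (prodg_base (r + 1) V2 \<union> prodg_top (r + 1) V2) = K + s + P * s"
    using card_prodg[of "r + 1" V2, OF fin2] by simp_all
  have g1: "gadget q 2 (prodg_base 2 V1 \<union> prodg_top 2 V1) (prodg 2 V1 E1) (prodg_top 2 V1)"
    by (rule gadget_prodg[OF vc1]) (use q in simp_all)
  have g2: "gadget q (r + 1) (prodg_base (r + 1) V2 \<union> prodg_top (r + 1) V2) (prodg (r + 1) V2 E2)
      (prodg_top (r + 1) V2)"
    by (rule gadget_prodg[OF vc2]) (use q in simp_all)
  have "\<exists>G. simple_graph G \<and> k_critical G (Suc q) \<and> triangle_free G \<and>
    card (verts G) = card (prodg_base 2 V1 \<union> prodg_top 2 V1) +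
      card (prodg_base (r + 1) V2 \<union> prodg_top (r + 1) V2) \<and>
    card (prodg_top 2 V1) * card (prodg_top (r + 1) V2) + card ({} :: ((nat \<times> nat) + (nat \<Rightarrow> nat)) set set)
      \<le> card (edges G)"
    by (rule critical_of_gadgets[OF g1 g2]) (use q in simp_all)
  then obtain G where G: "simple_graph G" "k_critical G k" "triangle_free G"
    "card (verts G) = card T0 + card T1 + b + (K + s + P * s)" "b * (P * s) \<le> card (edges G)"
    unfolding c1 c2 q(2) by auto
  \<comment> \<open>Both tuple sets have at most \<open>b\<close> elements. The four remaining
    summands \<open>card T0\<close>, \<open>card T1\<close>, \<open>K\<close> and \<open>s\<close>
    are at most \<open>b / M\<close> each, whence \<open>2 * M + 4\<close>; for \<open>s\<close>
    this rests on \<open>M \<le> P\<close>.\<close>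
  have "M * s \<le> P * s" using MP by (rule mult_le_mono1)
  then have "M * s \<le> b" using sP(1) by (rule le_trans)
  moreover have "M * (P * s) \<le> M * b" using sP(1) by (rule mult_le_mono2)
  ultimately have "M * card (verts G) \<le> (2 * M + 4) * b"
    unfolding G(4) using bT bK by (simp only: distrib_left distrib_right)
  moreover have "b * b * (M - 1) \<le> M * card (edges G)"
  proof -
    \<comment> \<open>The imbalance \<open>4 * P\<close> is at most \<open>b / M\<close>, so the
      second side has at least \<open>b * (1 - 1 / M)\<close> tuples.\<close>
    have "M * b \<le> M * (P * s + 4 * P)" using sP(2) by (rule mult_le_mono2)
    also have "\<dots> \<le> M * (P * s) + b" using b4 by (simp add: distrib_left mult.commute mult.left_commute)
    finally have "b * (M - 1) \<le> M * (P * s)" by (simp add: diff_mult_distrib2 mult.commute)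
    then have "b * (b * (M - 1)) \<le> b * (M * (P * s))" by (rule mult_le_mono2)
    also have "\<dots> = M * (b * (P * s))" by simp
    also have "\<dots> \<le> M * card (edges G)" using G(5) by (rule mult_le_mono2)
    finally show ?thesis by (simp add: mult.assoc)
  qed
  moreover have "N \<le> card (verts G)" using T0(2) unfolding G(4) L_def by linarith
  ultimately show ?thesis using G(1-3) b0 by blast
qed

lemma dense_critical_ge_6:
  assumes k: "k \<ge> 6" and c: "c < 1 / 4" and c0: "c \<ge> 0"
  shows "dense_critical k c"
  unfolding dense_critical_def
proof
  fix N :: nat
  \<comment> \<open>Bounding \<open>c\<close> by 1/4 in the lower terms of
    \<open>c * (2 * M + 4)\<^sup>2 < M * (M - 1)\<close> leaves
    \<open>5 * M + 4 < M\<^sup>2 * (1 - 4 * c)\<close>, and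
    \<open>5 * M + 4 \<le> 9 * M\<close>.\<close>
  obtain M0 :: nat where M0: "9 / (1 - 4 * c) < real M0" using reals_Archimedean2 by blast
  define M where "M = M0 + 1"
  have M: "M \<ge> 1" "9 / (1 - 4 * c) < real M" using M0 by (simp_all add: M_def)
  have "9 < real M * (1 - 4 * c)" using M(2) c by (simp add: pos_divide_less_eq)
  then have "real M * 9 < real M * (real M * (1 - 4 * c))" using M(1) by simp
  moreover have "c * (16 * real M + 16) \<le> 1 / 4 * (16 * real M + 16)"
    using c by (intro mult_right_mono) simp_all
  moreover have "1 \<le> real M" using M(1) by simp
  ultimately have less: "c * (2 * real M + 4)\<^sup>2 < real M * (real M - 1)"
    by (simp add: power2_eq_square algebra_simps)
  obtain G b where G: "simple_graph G" "k_critical G k" "triangle_free G" "N \<le> card (verts G)"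
    and b: "b > 0" "M * card (verts G) \<le> (2 * M + 4) * b" "b * b * (M - 1) \<le> M * card (edges G)"
    using ex_critical_balanced[OF k M(1)] by blast
  have n: "real M * real (card (verts G)) \<le> (2 * real M + 4) * real b"
    using of_nat_mono[OF b(2), where ?'a = real] by simp
  have e: "(real b)\<^sup>2 * (real M - 1) \<le> real M * real (card (edges G))"
    using of_nat_mono[OF b(3), where ?'a = real] M(1) by (simp add: power2_eq_square)
  have "(real M)\<^sup>2 * (c * (real (card (verts G)))\<^sup>2) = c * (real M * real (card (verts G)))\<^sup>2"
    by (simp add: power_mult_distrib)
  also have "\<dots> \<le> c * ((2 * real M + 4) * real b)\<^sup>2"
    using n c0 by (intro mult_left_mono power_mono) simp_all
  also have "\<dots> = (c * (2 * real M + 4)\<^sup>2) * (real b)\<^sup>2" by (simp add: power_mult_distrib)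
  also have "\<dots> < (real M * (real M - 1)) * (real b)\<^sup>2"
    using less b(1) by (intro mult_strict_right_mono) simp_all
  also have "\<dots> = real M * ((real b)\<^sup>2 * (real M - 1))" by simp
  also have "\<dots> \<le> real M * (real M * real (card (edges G)))" using e by (intro mult_left_mono) simp_all
  also have "\<dots> = (real M)\<^sup>2 * real (card (edges G))" by (simp add: power2_eq_square)
  finally have "c * (real (card (verts G)))\<^sup>2 < real (card (edges G))"
    using M(1) by (simp add: mult_less_cancel_left)
  then show "\<exists>G. simple_graph G \<and> k_critical G k \<and> triangle_free G \<and> N \<le> card (verts G) \<and>
      c * (real (card (verts G)))\<^sup>2 < real (card (edges G))"
    using G by blast
qed

theorem theorem1:
  shows "(\<exists>c :: real. c > 0 \<and> (\<exists>F :: graph set.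
            (\<forall>G\<in>F. simple_graph G \<and> triangle_free G \<and> critical G \<and>
                 real (card (edges G)) > c * (real (card (verts G)))\<^sup>2) \<and>
            (\<forall>k\<ge>4. \<forall>N :: nat. \<exists>G\<in>F. chromatic_number G = k \<and> card (verts G) \<ge> N)))
       \<and> density_constant 3 4 \<ge> 1 / 16
       \<and> density_constant 3 5 \<ge> 4 / 31
       \<and> (\<forall>k\<ge>6. density_constant 3 k = 1 / 4)"
proof (intro conjI allI impI)
  have d5: "dense_critical 5 c" if "c < 4 / 31" for c
    \<comment> \<open>A negative \<open>c\<close> is reduced to \<open>0\<close> by
      monotonicity.\<close>
    using dense_critical_mono[OF dense_critical_5[of "max c 0"]] that by simp
  have d6: "dense_critical k c" if "k \<ge> 6" "c < 1 / 4" for k c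
    using dense_critical_mono[OF dense_critical_ge_6[of k "max c 0"]] that by simp
  show "1 / 16 \<le> density_constant 3 4" by (rule density_constant_ge[OF dense_critical_4])
  show "4 / 31 \<le> density_constant 3 5" by (rule density_constant_ge[OF d5])
  show "density_constant 3 k = 1 / 4" if "k \<ge> 6" for k
    using density_constant_ge[OF d6[OF that]] density_constant_le[OF d6[OF that, of 0]] by fastforce
  \<comment> \<open>Any positive constant below 1/16, the least of the three bounds, would serve in
    place of \<open>1 / 32\<close>.\<close>
  define F where "F = {G. simple_graph G \<and> triangle_free G \<and> critical G \<and>
    real (card (edges G)) > 1 / 32 * (real (card (verts G)))\<^sup>2}"
  have "\<exists>G\<in>F. chromatic_number G = k \<and> card (verts G) \<ge> N" if k: "k \<ge> 4" for k N
  proof -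
    consider "k = 4" | "k = 5" | "k \<ge> 6" using k by linarith
    then have "dense_critical k (1 / 32)"
      using dense_critical_4[of "1 / 32"] d5[of "1 / 32"] d6[of k "1 / 32"] by cases simp_all
    then obtain G where G: "simple_graph G" "k_critical G k" "triangle_free G" "N \<le> card (verts G)"
      "1 / 32 * (real (card (verts G)))\<^sup>2 < real (card (edges G))"
      unfolding dense_critical_def by blast
    moreover have "critical G" using G(2) unfolding critical_def by blast
    moreover have "chromatic_number G = k" using G(2) unfolding k_critical_def by blast
    ultimately show ?thesis unfolding F_def by blast
  qed
  then show "\<exists>c :: real. c > 0 \<and> (\<exists>F :: graph set.
            (\<forall>G\<in>F. simple_graph G \<and> triangle_free G \<and> critical G \<and>
                 real (card (edges G)) > c * (real (card (verts G)))\<^sup>2) \<and>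
            (\<forall>k\<ge>4. \<forall>N :: nat. \<exists>G\<in>F. chromatic_number G = k \<and> card (verts G) \<ge> N))"
    by (intro exI[of _ "1 / 32 :: real"] conjI exI[of _ F]) (auto simp: F_def)
qed

end
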